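(* Let $n\ge1$, $m\ge0$, and let $\Omega\subseteq\mathbb C^{n+m}$ be a domain (not necessarily bounded) which is $n$-star-shaped Hartogs in the first $n$ variables $z=(z_1,\dots,z_n)$; write points as $(z,z')$ with $z'\in\mathbb C^m$. Let $\gamma=(\gamma_1,\dots,\gamma_n)$ with all $\gamma_j>0$ and put $$V^\gamma=\big\{(z,z',w)\in\mathbb C^{n+m}\times\mathbb C:\ (g_\gamma(z,w),z')\in\Omega\big\},\qquad g_\gamma(z,w)=\big(e^{\gamma_1|w|^2/2}z_1,\dots,e^{\gamma_n|w|^2/2}z_n\big).$$ For $\eta\in\mathbb C$ let $V^\gamma_\eta=\{(z,z')\in\mathbb C^{n+m}:(z,z',\eta)\in V^\gamma\}$ with Bergman kernel $K_{V^\gamma_\eta}$. Define $$l(z,w,\eta)=\big(z_1e^{\gamma_1(w\bar\eta-|\eta|^2)},\dots,z_ne^{\gamma_n(w\bar\eta-|\eta|^2)}\big),\qquad D_{V^\gamma}=\frac{e^{(\gamma\cdot\mathbf 1)(w\bar\eta-|\eta|^2)}}{\pi}\Big(\sum_{j=1}^n\gamma_j\Big(I+z_j\frac{\partial}{\partial z_j}\Big)\Big),$$ where $I$ is the identity and $\gamma\cdot\mathbf 1=\sum_j\gamma_j$. Then for all $(z,z',w;\zeta,\zeta',\eta)\in V^\gamma\times V^\gamma$, $$K_{V^\gamma}(z,z',w;\bar\zeta,\bar\zeta',\bar\eta)=D_{V^\gamma}\Big[K_{V^\gamma_\eta}\big(l(z,w,\eta),z';\bar\zeta,\bar\zeta'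\big)\Big].$$
   Context: A domain $\Omega\subseteq\mathbb C^{n+m}$ is called $n$-star-shaped Hartogs in $(z_1,\dots,z_n)$ if $(z_1,\dots,z_n,\zeta)\in\Omega$ implies $(\lambda_1z_1,\dots,\lambda_nz_n,\zeta)\in\Omega$ for all $\lambda_j\in\mathbb C$ with $|\lambda_j|\le1$. The Bergman kernel of a domain $D$ is the reproducing kernel of $A^2(D)$, the square-integrable holomorphic functions on $D$ (possibly the zero space). The differential operator acts on the function $(z,z',w)\mapsto K_{V^\gamma_\eta}(l(z,w,\eta),z';\bar\zeta,\bar\zeta')$, with $\partial/\partial z_j$ differentiating in $z_j$. *)

theory Defs
  imports "HOL-Analysis.Analysis"
begin

text \<open>Holomorphy on an open set of a finite-dimensional complex space, given the
  multiplication-by-i map J of that space: f is (Frechet) differentiable with a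
  complex-linear derivative at every point.\<close>
definition cholo_on :: "('a::euclidean_space \<Rightarrow> 'a) \<Rightarrow> ('a \<Rightarrow> complex) \<Rightarrow> 'a set \<Rightarrow> bool" where
  "cholo_on J f D \<longleftrightarrow> (\<forall>x\<in>D. \<exists>L. (f has_derivative L) (at x) \<and> (\<forall>v. L (J v) = \<i> * L v))"

definition A2 :: "('a::euclidean_space \<Rightarrow> 'a) \<Rightarrow> 'a set \<Rightarrow> ('a \<Rightarrow> complex) set" where
  "A2 J D = {f. cholo_on J f D \<and> set_integrable lebesgue D (\<lambda>x. (cmod (f x))\<^sup>2)}"

text \<open>Bergman kernel K(x,y) (holomorphic in x, antiholomorphic in y), i.e. the
  reproducing kernel: K(.,y) in A2 and f(y) = integral of f(x) * conj(K(x,y)).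
  Normalised to 0 outside D x D.\<close>
definition bergman_gen :: "('a::euclidean_space \<Rightarrow> 'a) \<Rightarrow> 'a set \<Rightarrow> 'a \<Rightarrow> 'a \<Rightarrow> complex" where
  "bergman_gen J D = (THE K. (\<forall>x y. (x \<notin> D \<or> y \<notin> D) \<longrightarrow> K x y = 0) \<and>
      (\<forall>y\<in>D. (\<lambda>x. K x y) \<in> A2 J D \<and>
         (\<forall>f\<in>A2 J D. f y = (LINT x:D|lebesgue. f x * cnj (K x y)))))"

definition bergman_vec :: "(complex^'n) set \<Rightarrow> complex^'n \<Rightarrow> complex^'n \<Rightarrow> complex" where
  "bergman_vec D = bergman_gen (\<lambda>v. \<i> *s v) D"

definition bergman_prod :: "((complex^'n) \<times> complex) set \<Rightarrow> (complex^'n) \<times> complex \<Rightarrow> (complex^'n) \<times> complex \<Rightarrow> complex" where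
  "bergman_prod D = bergman_gen (\<lambda>(v,t). (\<i> *s v, \<i> * t)) D"

text \<open>C^(n+m) is complex^'N; the set S of indices are the coordinates z_1..z_n, the
  remaining ones (possibly none) are z'.\<close>
definition star_hartogs :: "'N set \<Rightarrow> (complex^'N) set \<Rightarrow> bool" where
  "star_hartogs S \<Omega> \<longleftrightarrow> (\<forall>x\<in>\<Omega>. \<forall>c::'N \<Rightarrow> complex. (\<forall>j\<in>S. cmod (c j) \<le> 1) \<longrightarrow>
       (\<chi> j. if j \<in> S then c j * x$j else x$j) \<in> \<Omega>)"

definition g_gamma :: "'N set \<Rightarrow> ('N \<Rightarrow> real) \<Rightarrow> complex^'N \<Rightarrow> complex \<Rightarrow> complex^'N" where
  "g_gamma S \<gamma> x w = (\<chi> j. if j \<in> S then exp (complex_of_real (\<gamma> j * (cmod w)\<^sup>2 / 2)) * x$j else x$j)"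

definition V_gamma :: "'N set \<Rightarrow> ('N \<Rightarrow> real) \<Rightarrow> (complex^'N) set \<Rightarrow> ((complex^'N) \<times> complex) set" where
  "V_gamma S \<gamma> \<Omega> = {(x, w). g_gamma S \<gamma> x w \<in> \<Omega>}"

definition V_slice :: "'N set \<Rightarrow> ('N \<Rightarrow> real) \<Rightarrow> (complex^'N) set \<Rightarrow> complex \<Rightarrow> (complex^'N) set" where
  "V_slice S \<gamma> \<Omega> \<eta> = {x. (x, \<eta>) \<in> V_gamma S \<gamma> \<Omega>}"

definition l_map :: "'N set \<Rightarrow> ('N \<Rightarrow> real) \<Rightarrow> complex^'N \<Rightarrow> complex \<Rightarrow> complex \<Rightarrow> complex^'N" where
  "l_map S \<gamma> x w \<eta> = (\<chi> j. if j \<in> S then x$j * exp (complex_of_real (\<gamma> j) * (w * cnj \<eta> - complex_of_real ((cmod \<eta>)\<^sup>2))) else x$j)"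

definition pderiv_z :: "((complex^'N) \<times> complex \<Rightarrow> complex) \<Rightarrow> 'N \<Rightarrow> (complex^'N) \<times> complex \<Rightarrow> complex" where
  "pderiv_z F j p = deriv (\<lambda>t. F ((\<chi> k. if k = j then t else (fst p)$k), snd p)) ((fst p)$j)"

definition D_op :: "'N set \<Rightarrow> ('N \<Rightarrow> real) \<Rightarrow> complex \<Rightarrow> ((complex^'N) \<times> complex \<Rightarrow> complex) \<Rightarrow> (complex^'N) \<times> complex \<Rightarrow> complex" where
  "D_op S \<gamma> \<eta> F p =
     exp (complex_of_real (\<Sum>j\<in>S. \<gamma> j) * (snd p * cnj \<eta> - complex_of_real ((cmod \<eta>)\<^sup>2))) / complex_of_real pi *
     (\<Sum>j\<in>S. complex_of_real (\<gamma> j) * (F p + (fst p)$j * pderiv_z F j p))"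

end

theory Submission
  imports Defs "HOL-Complex_Analysis.Conformal_Mappings"
begin

text \<open>
  Write \<open>V\<close> for \<open>V_gamma S \<gamma> \<Omega>\<close>, \<open>\<Gamma>\<close> for the sum of the \<open>\<gamma> j\<close> and \<open>e^(\<gamma> a) x\<close> for the point with coordinates
  \<open>e^(\<gamma> j a) x_j\<close> for \<open>j \<in> S\<close>. The automorphisms \<open>(x, w) \<mapsto> (e^(\<gamma> (w cnj \<eta> - |\<eta>|^2/2)) x, w - \<eta>)\<close> of \<open>V\<close> reduce
  the formula to \<open>\<eta> = 0\<close>, and rotations of \<open>w\<close> show that \<open>k x = K_V((x, w), (\<zeta>, 0))\<close> does not depend on \<open>w\<close>.

  For imaginary \<open>a\<close> the map \<open>e^(\<gamma> a)\<close> is an automorphism of \<open>\<Omega>\<close>, so by the identity theorem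
  \<open>K_\<Omega>(e^(\<gamma> a) y, x) = K_\<Omega>(y, e^(\<gamma> cnj a) x)\<close> for all admissible \<open>a\<close>. Real \<open>a\<close> rescale \<open>\<Omega>\<close> to the slices \<open>V_w\<close>;
  together this identifies \<open>K_\<Omega>(-, x)\<close> on \<open>V_w\<close> with \<open>e^(-\<Gamma> |w|^2) K_(V_w)(-, e^(-\<gamma> |w|^2) x)\<close>, whose inner
  product with \<open>f\<close> is \<open>T_s f x = e^(-\<Gamma> s) f (e^(-\<gamma> s) x)\<close> at \<open>s = |w|^2\<close>. Hence \<open>K_\<Omega>(-, x)\<close>, regarded as a
  function on \<open>V\<close>, is square integrable, and reproducing it gives \<open>K_\<Omega>(x, \<zeta>) = pi * (integral of T_s k x over s \<ge> 0)\<close>.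
  As \<open>T\<close> is a semigroup, \<open>T_a\<close> of the left-hand side is the same integral over \<open>s \<ge> a\<close>, and differentiating at
  \<open>a = 0\<close> gives \<open>pi * k = (\<Sum>j\<in>S. \<gamma> j (I + x_j \<partial>_j)) K_\<Omega>(-, \<zeta>)\<close>.
\<close>

section \<open>Lebesgue measure under linear maps\<close>

lemma nn_integral_lborel_plus:
  fixes f :: "'a::euclidean_space \<Rightarrow> ennreal"
  assumes [measurable]: "f \<in> borel_measurable borel"
  shows "(\<integral>\<^sup>+x. f (a + x) \<partial>lborel) = (\<integral>\<^sup>+x. f x \<partial>lborel)"
  using nn_integral_distr[of "(+) a" lborel borel f] by (simp add: lborel_distr_plus)

lemma nn_integral_lborel_minus:
  fixes f :: "'a::euclidean_space \<Rightarrow> ennreal"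
  assumes [measurable]: "f \<in> borel_measurable borel"
  shows "(\<integral>\<^sup>+x. f (a - x) \<partial>lborel) = (\<integral>\<^sup>+x. f x \<partial>lborel)"
proof -
  have "distr lborel borel (\<lambda>x::'a. a - x) = lborel"
    using lborel_affine[of "-1" a] by (simp add: density_1)
  then show ?thesis
    using nn_integral_distr[of "\<lambda>x. a - x" lborel borel f] by simp
qed

lemma translation_invariant_proportional_lborel:
  fixes M :: "'a::euclidean_space measure"
  assumes sets_M[measurable_cong]: "sets M = sets borel"
    and "sigma_finite_measure M"
    and invariant: "\<And>a. distr M borel ((+) a) = M"
    and [measurable]: "A \<in> sets borel" "B \<in> sets borel"
  shows "emeasure M A * emeasure lborel B = emeasure M B * emeasure lborel A"
proof -
  interpret M: sigma_finite_measure M by fact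
  interpret pair_sigma_finite M "lborel :: 'a measure" ..
  have M_plus: "(\<integral>\<^sup>+x. f (a + x) \<partial>M) = (\<integral>\<^sup>+x. f x \<partial>M)"
    if [measurable]: "f \<in> borel_measurable borel" for f :: "'a \<Rightarrow> ennreal" and a
    using nn_integral_distr[of "(+) a" M borel f] by (simp add: invariant)
  have "emeasure M A * emeasure lborel B = (\<integral>\<^sup>+x. indicator A x * (\<integral>\<^sup>+y. indicator B (x + y) \<partial>lborel) \<partial>M)"
    using nn_integral_lborel_plus[of "indicator B"] by (simp add: nn_integral_multc sets_M)
  also have "\<dots> = (\<integral>\<^sup>+x. \<integral>\<^sup>+y. indicator A x * indicator B (x + y) \<partial>lborel \<partial>M)"
    by (simp add: nn_integral_cmult)
  also have "\<dots> = (\<integral>\<^sup>+y. \<integral>\<^sup>+x. indicator A x * indicator B (x + y) \<partial>M \<partial>lborel)"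
    by (rule Fubini'[symmetric]) measurable
  also have "\<dots> = (\<integral>\<^sup>+y. \<integral>\<^sup>+x. indicator A (x - y) * indicator B x \<partial>M \<partial>lborel)"
  proof (rule nn_integral_cong)
    fix y :: 'a
    show "(\<integral>\<^sup>+x. indicator A x * indicator B (x + y) \<partial>M) = (\<integral>\<^sup>+x. indicator A (x - y) * indicator B x \<partial>M)"
      using M_plus[of "\<lambda>x. indicator A (x - y) * indicator B x" y] by (simp add: add.commute)
  qed
  also have "\<dots> = (\<integral>\<^sup>+x. \<integral>\<^sup>+y. indicator A (x - y) * indicator B x \<partial>lborel \<partial>M)"
    by (rule Fubini') measurable
  also have "\<dots> = (\<integral>\<^sup>+x. (\<integral>\<^sup>+y. indicator A (x - y) \<partial>lborel) * indicator B x \<partial>M)"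
    by (simp add: nn_integral_multc)
  also have "\<dots> = emeasure M B * emeasure lborel A"
    using nn_integral_lborel_minus[of "indicator A"]
    by (simp add: nn_integral_multc sets_M mult.commute)
  finally show ?thesis .
qed

lemma translation_invariant_eq_lborelI:
  fixes M :: "'a::euclidean_space measure"
  assumes sets_M: "sets M = sets borel"
    and invariant: "\<And>a. distr M borel ((+) a) = M"
    and cball_eq: "\<And>r. emeasure M (cball 0 r) = emeasure lborel (cball (0::'a) r)"
  shows "M = lborel"
proof (rule measure_eqI)
  have "sigma_finite_measure M"
  proof
    have "(\<Union>n::nat. cball (0::'a) (real n)) = UNIV"
      using real_arch_simple by (fastforce simp: dist_norm)
    moreover have "emeasure M (cball 0 r) \<noteq> top" for r
      using emeasure_lborel_cball_finite[of "0::'a" r] by (simp add: cball_eq less_top)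
    moreover have "space M = UNIV"
      using sets_eq_imp_space_eq[OF sets_M] by simp
    ultimately show "\<exists>A. countable A \<and> A \<subseteq> sets M \<and> \<Union> A = space M \<and> (\<forall>a\<in>A. emeasure M a \<noteq> \<infinity>)"
      by (intro exI[of _ "range (\<lambda>n::nat. cball (0::'a) (real n))"]) (auto simp: sets_M)
  qed
  then have proportional:
    "emeasure M A * emeasure lborel (cball (0::'a) 1) = emeasure lborel A * emeasure lborel (cball (0::'a) 1)"
    if "A \<in> sets borel" for A
    using translation_invariant_proportional_lborel[OF sets_M _ invariant that, of "cball 0 1"]
    by (simp add: cball_eq mult.commute)
  have "emeasure lborel (cball (0::'a) 1) \<noteq> 0"
    using content_ball_pos[of 1 "0::'a"] by (simp add: emeasure_cball less_imp_neq[symmetric])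
  moreover have "emeasure lborel (cball (0::'a) 1) < top"
    using emeasure_lborel_cball_finite[of "0::'a" 1] by simp
  ultimately show "emeasure M A = emeasure lborel A" if "A \<in> sets M" for A
    using proportional[of A] that sets_M by (metis ennreal_mult_cancel_left less_irrefl mult.commute)
qed (simp add: sets_M)

lemma borel_measurable_linear:
  fixes U :: "'a::euclidean_space \<Rightarrow> 'b::euclidean_space"
  assumes "linear U"
  shows "U \<in> borel_measurable borel"
  using assms by (intro borel_measurable_continuous_onI linear_continuous_on)
    (simp add: linear_conv_bounded_linear)

lemma lborel_distr_linear_isometry:
  fixes U :: "'a::euclidean_space \<Rightarrow> 'a"
  assumes "linear U" and norm_U: "\<And>x. norm (U x) = norm x"
  shows "distr lborel borel U = lborel"
proof (rule translation_invariant_eq_lborelI)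
  interpret linear U by fact
  have [measurable]: "U \<in> borel_measurable borel"
    using \<open>linear U\<close> by (rule borel_measurable_linear)
  have "inj U"
    by (metis linear_injective_0[OF \<open>linear U\<close>] norm_U norm_eq_zero)
  then have "surj U"
    using linear_injective_imp_surjective[OF \<open>linear U\<close>] by simp
  show "distr (distr lborel borel U) borel ((+) a) = distr lborel borel U" for a
  proof -
    obtain b where b: "a = U b"
      using \<open>surj U\<close> by (metis surjD)
    have "distr (distr lborel borel U) borel ((+) a) = distr lborel borel (\<lambda>x. U (b + x))"
      by (subst distr_distr) (auto simp: o_def b add)
    also have "\<dots> = distr (distr lborel borel ((+) b)) borel U"
      by (subst distr_distr) (auto simp: o_def)
    finally show ?thesis
      by (simp add: lborel_distr_plus)
  qed
  show "emeasure (distr lborel borel U) (cball 0 r) = emeasure lborel (cball (0::'a) r)" for r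
    by (simp add: emeasure_distr vimage_def norm_U cball_def)
qed simp

lemma nn_integral_isometry_average:
  fixes R :: "real \<Rightarrow> 'a::euclidean_space \<Rightarrow> 'a" and H :: "'a \<Rightarrow> ennreal"
  assumes lin: "\<And>t. linear (R t)" and iso: "\<And>t x. norm (R t x) = norm x"
    and cont: "continuous_on UNIV (\<lambda>p. R (fst p) (snd p))"
    and [measurable]: "H \<in> borel_measurable borel" and "a \<le> b"
  shows "(\<integral>\<^sup>+x. (\<integral>\<^sup>+t\<in>{a..b}. H (R t x) \<partial>lborel) \<partial>lborel) = ennreal (b - a) * (\<integral>\<^sup>+x. H x \<partial>lborel)"
proof -
  have "(\<lambda>p. R (fst p) (snd p)) \<in> borel_measurable (lborel \<Otimes>\<^sub>M lborel)"
    using borel_measurable_continuous_onI[OF cont] by (simp add: lborel_prod)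
  then have [measurable]: "(\<lambda>p. R (fst p) (snd p)) \<in> lborel \<Otimes>\<^sub>M lborel \<rightarrow>\<^sub>M borel" .
  have [measurable]: "R t \<in> borel_measurable borel" for t
    using lin by (rule borel_measurable_linear)
  have "(\<integral>\<^sup>+x. (\<integral>\<^sup>+t\<in>{a..b}. H (R t x) \<partial>lborel) \<partial>lborel)
      = (\<integral>\<^sup>+t. \<integral>\<^sup>+x. H (R t x) * indicator {a..b} t \<partial>lborel \<partial>lborel)"
    by (rule lborel_pair.Fubini'[of "\<lambda>t x. H (R t x) * indicator {a..b} t"]) (simp add: case_prod_beta')
  also have "\<dots> = (\<integral>\<^sup>+t. (\<integral>\<^sup>+x. H x \<partial>lborel) * indicator {a..b} t \<partial>lborel)"
    using nn_integral_distr[of "R t" lborel borel H for t]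
    by (simp add: nn_integral_multc lborel_distr_linear_isometry[OF lin iso])
  also have "\<dots> = ennreal (b - a) * (\<integral>\<^sup>+x. H x \<partial>lborel)"
    using \<open>a \<le> b\<close> by (simp add: nn_integral_cmult mult.commute)
  finally show ?thesis .
qed

lemma distr_density_eq_lborelI:
  fixes \<Phi> :: "'a::euclidean_space \<Rightarrow> 'b::euclidean_space"
  assumes [measurable]: "\<Phi> \<in> borel_measurable borel" "h \<in> borel_measurable borel"
    and "\<And>A. A \<in> sets borel \<Longrightarrow> (\<integral>\<^sup>+x. indicator A (\<Phi> x) * h x \<partial>lborel) = emeasure lborel A"
  shows "distr (density lborel h) borel \<Phi> = lborel"
proof (rule measure_eqI)
  fix A assume "A \<in> sets (distr (density lborel h) borel \<Phi>)"
  then have [measurable]: "A \<in> sets borel" by simp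
  have "emeasure (distr (density lborel h) borel \<Phi>) A = (\<integral>\<^sup>+x. indicator A (\<Phi> x) * h x \<partial>lborel)"
    using nn_integral_distr[of \<Phi> "density lborel h" borel "indicator A"]
    by (simp add: nn_integral_density mult.commute)
  then show "emeasure (distr (density lborel h) borel \<Phi>) A = emeasure lborel A"
    using assms(3) by simp
qed simp

definition dscale :: "('N \<Rightarrow> complex) \<Rightarrow> complex^'N \<Rightarrow> complex^'N::finite" where
  "dscale c x = (\<chi> j. c j * x$j)"

lemma dscale_nth [simp]: "dscale c x $ j = c j * x $ j"
  by (simp add: dscale_def)

lemma linear_dscale: "linear (dscale c)"
  by (rule linearI) (simp_all add: vec_eq_iff algebra_simps)

lemma borel_measurable_dscale [measurable]: "dscale c \<in> borel_measurable borel"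
  by (rule borel_measurable_linear[OF linear_dscale])

lemma continuous_on_dscale:
  assumes "\<And>j. continuous_on A (\<lambda>p. c p j)" "continuous_on A f"
  shows "continuous_on A (\<lambda>p. dscale (c p) (f p))"
  unfolding dscale_def using assms by (intro continuous_intros) auto

lemma norm_dscale_unimodular: "(\<And>j. cmod (c j) = 1) \<Longrightarrow> norm (dscale c x) = norm x"
  by (simp add: norm_vec_def norm_mult)

lemma norm_dscale_axis: "norm (dscale c (axis j b)) = cmod (c j) * cmod b"
proof -
  have "dscale c (axis j b) = axis j (c j * b)"
    by (auto simp: vec_eq_iff axis_def)
  then show ?thesis
    by (simp add: norm_eq_sqrt_inner[of "axis _ _"] inner_axis_axis norm_eq_sqrt_inner[symmetric] norm_mult)
qed

lemma prod_Basis_vec: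
  fixes h :: "'a::euclidean_space^'N::finite \<Rightarrow> 'b::comm_monoid_mult"
  shows "(\<Prod>b\<in>Basis. h b) = (\<Prod>j\<in>UNIV. \<Prod>b\<in>Basis. h (axis j b))"
proof -
  have inj: "inj_on (\<lambda>(j, b). axis j b :: 'a^'N) (UNIV \<times> Basis)"
    by (auto simp: inj_on_def axis_eq_axis)
  have "Basis = (\<lambda>(j, b). axis j b :: 'a^'N) ` (UNIV \<times> Basis)"
    by (auto simp: Basis_vec_def)
  then have "(\<Prod>b\<in>Basis. h b) = (\<Prod>p\<in>UNIV \<times> Basis. h (case p of (j, b) \<Rightarrow> axis j b))"
    using prod.reindex[OF inj, of h] by (simp add: o_def)
  then show ?thesis
    by (simp add: prod.cartesian_product split_def)
qed

lemma lborel_distr_dscale_of_real: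
  fixes r :: "'N::finite \<Rightarrow> real"
  assumes pos: "\<And>j. r j > 0"
  shows "distr (density lborel (\<lambda>_. ennreal (\<Prod>j\<in>UNIV. (r j)\<^sup>2))) borel (dscale (\<lambda>j. of_real (r j))) = lborel"
proof -
  let ?r = "dscale (\<lambda>j. complex_of_real (r j))"
  have axis_r: "norm (?r (axis j b)) = r j" if "b \<in> Basis" for j b
    using that less_imp_le[OF pos] by (simp add: norm_dscale_axis)
  have "(\<Sum>b\<in>Basis. (norm (?r b) * (x \<bullet> b)) *\<^sub>R b) = ?r x" for x :: "complex^'N"
  proof (rule euclidean_eqI)
    fix b :: "complex^'N" assume b: "b \<in> Basis"
    then obtain j b' where jb: "b = axis j b'" "b' \<in> Basis"
      by (auto simp: Basis_vec_def)
    have "(\<Sum>b\<in>Basis. (norm (?r b) * (x \<bullet> b)) *\<^sub>R b) \<bullet> b = r j * (x \<bullet> b)"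
      using b axis_r[OF jb(2), of j]
      by (simp add: inner_sum_left inner_Basis if_distrib jb(1)[symmetric] cong: if_cong)
    also have "\<dots> = ?r x \<bullet> b"
      by (simp add: jb(1) inner_axis inner_mult_right scaleR_conv_of_real[symmetric])
    finally show "(\<Sum>b\<in>Basis. (norm (?r b) * (x \<bullet> b)) *\<^sub>R b) \<bullet> b = ?r x \<bullet> b" .
  qed
  moreover have "norm (?r b) \<noteq> 0" if b: "b \<in> Basis" for b :: "complex^'N"
  proof -
    obtain j b' where "b = axis j b'" "b' \<in> Basis"
      using b by (auto simp: Basis_vec_def)
    then show ?thesis
      using axis_r pos[of j] by simp
  qed
  moreover have "(\<Prod>b\<in>Basis. norm (?r b)) = (\<Prod>j\<in>UNIV. (r j)\<^sup>2)"
    by (simp add: prod_Basis_vec axis_r Basis_complex_def power2_eq_square)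
  ultimately have "lborel = density (distr lborel borel ?r) (\<lambda>_. ennreal (\<Prod>j\<in>UNIV. (r j)\<^sup>2))"
    using lborel_affine_euclidean[of "\<lambda>b. norm (?r b)" 0] by simp
  then show ?thesis
    by (simp add: density_distr)
qed

lemma lborel_distr_dscale:
  fixes c :: "'N::finite \<Rightarrow> complex"
  assumes nz: "\<And>j. c j \<noteq> 0"
  shows "distr (density lborel (\<lambda>_. ennreal (\<Prod>j\<in>UNIV. (cmod (c j))\<^sup>2))) borel (dscale c) = lborel"
proof -
  let ?k = "\<lambda>_. ennreal (\<Prod>j\<in>UNIV. (cmod (c j))\<^sup>2)"
  let ?modulus = "dscale (\<lambda>j. complex_of_real (cmod (c j)))" and ?phase = "dscale (\<lambda>j. sgn (c j))"
  have "distr lborel borel ?phase = lborel"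
    by (intro lborel_distr_linear_isometry linear_dscale norm_dscale_unimodular) (simp add: norm_sgn nz)
  then have phase: "distr (density lborel ?k) borel ?phase = density lborel ?k"
    using density_distr[of ?k borel ?phase lborel] by simp
  have "c j = of_real (cmod (c j)) * sgn (c j)" for j
    by (simp add: sgn_eq)
  then have "?modulus \<circ> ?phase = dscale c"
    by (auto simp: fun_eq_iff vec_eq_iff mult.assoc[symmetric])
  then have "distr (density lborel ?k) borel (dscale c)
      = distr (distr (density lborel ?k) borel ?phase) borel ?modulus"
    by (simp add: distr_distr)
  also have "\<dots> = lborel"
    unfolding phase using nz by (intro lborel_distr_dscale_of_real) simp
  finally show ?thesis .
qed

section \<open>Holomorphic maps between complex spaces\<close>

definition complex_structure :: "('a::euclidean_space \<Rightarrow> 'a) \<Rightarrow> bool" where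
  "complex_structure J \<longleftrightarrow> linear J \<and> (\<forall>v. J (J v) = - v) \<and> (\<forall>v. norm (J v) = norm v)"

definition cscale :: "('a::euclidean_space \<Rightarrow> 'a) \<Rightarrow> complex \<Rightarrow> 'a \<Rightarrow> 'a" where
  "cscale J \<mu> v = Re \<mu> *\<^sub>R v + Im \<mu> *\<^sub>R J v"

lemma linear_cscale_complex_linear:
  fixes L :: "'a::euclidean_space \<Rightarrow> complex"
  assumes "linear L" and "\<And>v. L (J v) = \<i> * L v"
  shows "L (cscale J \<mu> v) = \<mu> * L v"
  using assms by (simp add: cscale_def linear_add linear_scale complex_eq_iff)

lemma linear_cscale_left: "linear (\<lambda>\<mu>. cscale J \<mu> v)"
  by (intro linearI) (auto simp: cscale_def algebra_simps)

context
  fixes J :: "'a::euclidean_space \<Rightarrow> 'a"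
  assumes J: "complex_structure J"
begin

lemma linear_complex_structure: "linear J" and norm_complex_structure: "norm (J v) = norm v"
  using J by (auto simp: complex_structure_def)

lemma inner_complex_structure_self: "v \<bullet> J v = 0"
proof -
  have "orthogonal_transformation J"
    using linear_complex_structure norm_complex_structure by (simp add: orthogonal_transformation)
  then have "J v \<bullet> J (J v) = v \<bullet> J v"
    by (simp add: orthogonal_transformation_def)
  then show ?thesis
    using J by (simp add: complex_structure_def inner_commute)
qed

lemma norm_cscale: "norm (cscale J \<mu> v) = cmod \<mu> * norm v"
proof -
  have "(norm (cscale J \<mu> v))\<^sup>2 = (Re \<mu>)\<^sup>2 * (norm v)\<^sup>2 + (Im \<mu>)\<^sup>2 * (norm (J v))\<^sup>2"
    unfolding cscale_def power2_norm_eq_inner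
    by (simp add: inner_add_left inner_add_right inner_complex_structure_self inner_commute[of "J v" v]
        power2_eq_square)
  also have "\<dots> = (cmod \<mu> * norm v)\<^sup>2"
    by (simp add: norm_complex_structure cmod_def power_mult_distrib algebra_simps)
  finally show ?thesis
    by (simp add: power2_eq_iff_nonneg)
qed

lemma linear_cscale: "linear (cscale J \<mu>)"
  using linear_complex_structure
  by (intro linearI) (auto simp: cscale_def linear_add linear_scale algebra_simps)

lemma continuous_on_cscale:
  assumes "continuous_on A f" "continuous_on A g"
  shows "continuous_on A (\<lambda>p. cscale J (f p) (g p))"
proof -
  have "bounded_linear J"
    using linear_complex_structure by (simp add: linear_conv_bounded_linear)
  then show ?thesis
    unfolding cscale_def using assms
    by (intro continuous_intros bounded_linear.continuous_on[OF \<open>bounded_linear J\<close>])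
qed

end

definition cholo_map ::
    "('a::euclidean_space \<Rightarrow> 'a) \<Rightarrow> ('b::euclidean_space \<Rightarrow> 'b) \<Rightarrow> ('a \<Rightarrow> 'b) \<Rightarrow> 'a set \<Rightarrow> bool" where
  "cholo_map J J' \<Phi> D \<longleftrightarrow> (\<forall>x\<in>D. \<exists>L. (\<Phi> has_derivative L) (at x) \<and> (\<forall>v. L (J v) = J' (L v)))"

lemma cholo_on_eq_cholo_map: "cholo_on J f D \<longleftrightarrow> cholo_map J ((*) \<i>) f D"
  by (simp add: cholo_on_def cholo_map_def)

lemma cholo_map_compose:
  assumes "cholo_map J J' \<Phi> D" "cholo_map J' J'' \<Psi> D'" "\<And>x. x \<in> D \<Longrightarrow> \<Phi> x \<in> D'"
  shows "cholo_map J J'' (\<lambda>x. \<Psi> (\<Phi> x)) D"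
  unfolding cholo_map_def
proof
  fix x assume "x \<in> D"
  obtain L where L: "(\<Phi> has_derivative L) (at x)" "\<And>v. L (J v) = J' (L v)"
    using assms(1) \<open>x \<in> D\<close> unfolding cholo_map_def by blast
  obtain M where M: "(\<Psi> has_derivative M) (at (\<Phi> x))" "\<And>v. M (J' v) = J'' (M v)"
    using assms(2) assms(3)[OF \<open>x \<in> D\<close>] unfolding cholo_map_def by blast
  show "\<exists>L. ((\<lambda>x. \<Psi> (\<Phi> x)) has_derivative L) (at x) \<and> (\<forall>v. L (J v) = J'' (L v))"
    using has_derivative_compose[OF L(1) M(1)] by (auto simp: L(2) M(2))
qed

lemma cholo_on_compose:
  assumes "cholo_map J J' \<Phi> D" "cholo_on J' f D'" "\<And>x. x \<in> D \<Longrightarrow> \<Phi> x \<in> D'"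
  shows "cholo_on J (\<lambda>x. f (\<Phi> x)) D"
  using assms cholo_map_compose unfolding cholo_on_eq_cholo_map by blast

lemma cholo_map_linear: "linear L \<Longrightarrow> (\<And>v. L (J v) = J' (L v)) \<Longrightarrow> cholo_map J J' L D"
  unfolding cholo_map_def using linear_imp_has_derivative by blast

lemma cholo_map_Pair:
  assumes "cholo_map J J1 f D" "cholo_map J J2 g D"
  shows "cholo_map J (\<lambda>(a, b). (J1 a, J2 b)) (\<lambda>x. (f x, g x)) D"
  unfolding cholo_map_def
proof
  fix x assume "x \<in> D"
  obtain L where L: "(f has_derivative L) (at x)" "\<And>v. L (J v) = J1 (L v)"
    using assms(1) \<open>x \<in> D\<close> unfolding cholo_map_def by blast
  obtain M where M: "(g has_derivative M) (at x)" "\<And>v. M (J v) = J2 (M v)"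
    using assms(2) \<open>x \<in> D\<close> unfolding cholo_map_def by blast
  show "\<exists>L. ((\<lambda>x. (f x, g x)) has_derivative L) (at x) \<and> (\<forall>v. L (J v) = (\<lambda>(a, b). (J1 a, J2 b)) (L v))"
    using has_derivative_Pair[OF L(1) M(1)] by (auto simp: L(2) M(2))
qed

lemma has_derivative_vecI:
  fixes f :: "'a::real_normed_vector \<Rightarrow> 'b::euclidean_space^'n"
  assumes "\<And>j. ((\<lambda>x. f x $ j) has_derivative (\<lambda>h. f' h $ j)) (at a within A)"
  shows "(f has_derivative f') (at a within A)"
  unfolding has_derivative_componentwise_within[of f]
proof
  fix i :: "'b^'n" assume "i \<in> Basis"
  then obtain j b where i: "i = axis j b"
    by (auto simp: Basis_vec_def)
  show "((\<lambda>x. f x \<bullet> i) has_derivative (\<lambda>x. f' x \<bullet> i)) (at a within A)"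
    unfolding i inner_axis by (intro has_derivative_inner_left assms)
qed

lemma cholo_map_vecI:
  assumes "\<And>j. cholo_on J (\<lambda>x. \<Phi> x $ j) D"
  shows "cholo_map J ((*s) \<i>) \<Phi> D"
  unfolding cholo_map_def
proof
  fix x assume x: "x \<in> D"
  have "\<forall>j. \<exists>L. ((\<lambda>x. \<Phi> x $ j) has_derivative L) (at x) \<and> (\<forall>v. L (J v) = \<i> * L v)"
    using assms x unfolding cholo_on_def by blast
  then obtain L where L: "\<And>j. ((\<lambda>x. \<Phi> x $ j) has_derivative L j) (at x)" "\<And>j v. L j (J v) = \<i> * L j v"
    by metis
  have "(\<Phi> has_derivative (\<lambda>h. \<chi> j. L j h)) (at x)"
    by (rule has_derivative_vecI) (simp add: L)
  then show "\<exists>L. (\<Phi> has_derivative L) (at x) \<and> (\<forall>v. L (J v) = \<i> *s L v)"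
    by (auto simp: L vec_eq_iff)
qed

lemma cholo_on_complex_iff:
  assumes "open A"
  shows "cholo_on ((*) \<i>) h A \<longleftrightarrow> h holomorphic_on A"
proof -
  have "(\<exists>L. (h has_derivative L) (at x) \<and> (\<forall>v. L (\<i> * v) = \<i> * L v)) \<longleftrightarrow>
      (\<exists>d. (h has_field_derivative d) (at x))" for x
  proof
    assume "\<exists>L. (h has_derivative L) (at x) \<and> (\<forall>v. L (\<i> * v) = \<i> * L v)"
    then obtain L where L: "(h has_derivative L) (at x)" "\<And>v. L (\<i> * v) = \<i> * L v" by blast
    have "cscale ((*) \<i>) v 1 = v" for v
      by (simp add: cscale_def complex_eq_iff)
    then have "L v = L 1 * v" for v
      using linear_cscale_complex_linear[OF has_derivative_linear[OF L(1)] L(2), of v 1]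
      by (metis mult.commute)
    then have "L = (*) (L 1)"
      by blast
    then show "\<exists>d. (h has_field_derivative d) (at x)"
      using L(1) unfolding has_field_derivative_def by metis
  qed (auto simp: has_field_derivative_def)
  then show ?thesis
    by (simp add: cholo_on_def holomorphic_on_open[OF assms])
qed

lemma cholo_on_compose_holomorphic:
  assumes "cholo_on J f D" "h holomorphic_on A" "open A" "\<And>x. x \<in> D \<Longrightarrow> f x \<in> A"
  shows "cholo_on J (\<lambda>x. h (f x)) D"
  using assms cholo_on_compose cholo_on_complex_iff unfolding cholo_on_eq_cholo_map[of J f] by blast

lemma cholo_on_subset: "cholo_on J f D \<Longrightarrow> E \<subseteq> D \<Longrightarrow> cholo_on J f E"
  by (auto simp: cholo_on_def)

lemma cholo_on_cong: "open D \<Longrightarrow> (\<And>x. x \<in> D \<Longrightarrow> f x = g x) \<Longrightarrow> cholo_on J f D \<Longrightarrow> cholo_on J g D"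
  unfolding cholo_on_def by (metis has_derivative_transform_within_open)

lemma cholo_on_imp_continuous_on: "cholo_on J f D \<Longrightarrow> continuous_on D f"
  by (meson cholo_on_def continuous_at_imp_continuous_on has_derivative_continuous)

lemma cholo_on_linear: "linear f \<Longrightarrow> (\<And>v. f (J v) = \<i> * f v) \<Longrightarrow> cholo_on J f D"
  unfolding cholo_on_eq_cholo_map by (rule cholo_map_linear)

lemma cholo_on_const: "cholo_on J (\<lambda>x. c) D"
  unfolding cholo_on_def by (intro ballI exI[of _ "\<lambda>x. 0"]) auto

lemma cholo_on_add:
  assumes "cholo_on J f D" "cholo_on J g D"
  shows "cholo_on J (\<lambda>x. f x + g x) D"
  unfolding cholo_on_def
proof
  fix x assume "x \<in> D"
  obtain L where L: "(f has_derivative L) (at x)" "\<And>v. L (J v) = \<i> * L v"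
    using assms(1) \<open>x \<in> D\<close> unfolding cholo_on_def by blast
  obtain M where M: "(g has_derivative M) (at x)" "\<And>v. M (J v) = \<i> * M v"
    using assms(2) \<open>x \<in> D\<close> unfolding cholo_on_def by blast
  show "\<exists>L. ((\<lambda>x. f x + g x) has_derivative L) (at x) \<and> (\<forall>v. L (J v) = \<i> * L v)"
    using has_derivative_add[OF L(1) M(1)] by (auto simp: L(2) M(2) ring_distribs)
qed

lemma cholo_on_mult:
  assumes "cholo_on J f D" "cholo_on J g D"
  shows "cholo_on J (\<lambda>x. f x * g x) D"
  unfolding cholo_on_def
proof
  fix x assume "x \<in> D"
  obtain L where L: "(f has_derivative L) (at x)" "\<And>v. L (J v) = \<i> * L v"
    using assms(1) \<open>x \<in> D\<close> unfolding cholo_on_def by blast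
  obtain M where M: "(g has_derivative M) (at x)" "\<And>v. M (J v) = \<i> * M v"
    using assms(2) \<open>x \<in> D\<close> unfolding cholo_on_def by blast
  show "\<exists>L. ((\<lambda>x. f x * g x) has_derivative L) (at x) \<and> (\<forall>v. L (J v) = \<i> * L v)"
    using has_derivative_mult[OF L(1) M(1)]
    by (intro exI[of _ "\<lambda>v. f x * M v + L v * g x"]) (simp add: L(2) M(2) algebra_simps)
qed

lemma has_field_derivative_cscale_line:
  assumes L: "(f has_derivative L) (at (x + cscale J \<mu> v))" and LJ: "\<And>v. L (J v) = \<i> * L v"
  shows "((\<lambda>\<mu>. f (x + cscale J \<mu> v)) has_field_derivative L v) (at \<mu>)"
proof -
  have "((\<lambda>\<mu>. x + cscale J \<mu> v) has_derivative (\<lambda>t. 0 + cscale J t v)) (at \<mu>)"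
    by (intro has_derivative_add has_derivative_const linear_imp_has_derivative linear_cscale_left)
  from has_derivative_compose[OF this L] show ?thesis
    by (simp add: has_field_derivative_def linear_cscale_complex_linear[OF has_derivative_linear[OF L] LJ]
        mult_commute_abs)
qed

lemma holomorphic_on_cscale_line:
  assumes "cholo_on J f D" "\<And>\<mu>. \<mu> \<in> A \<Longrightarrow> x + cscale J \<mu> v \<in> D" "open A"
  shows "(\<lambda>\<mu>. f (x + cscale J \<mu> v)) holomorphic_on A"
  using assms has_field_derivative_cscale_line
  unfolding holomorphic_on_open[OF \<open>open A\<close>] cholo_on_def by metis

section \<open>Mean value inequality and Cauchy estimate\<close>

lemma mean_value_circle:
  assumes "u holomorphic_on A" and "cball 0 1 \<subseteq> A"
  shows "((\<lambda>t. u (cis t)) has_integral of_real (2 * pi) * u 0) {0..2 * pi}"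
proof -
  have "((\<lambda>z. u z / (z - 0)) has_contour_integral 2 * of_real pi * \<i> * u 0) (circlepath 0 1)"
    using assms by (intro Cauchy_integral_circlepath_simple) (auto intro: holomorphic_on_subset)
  then have "((\<lambda>t. u (cis t) * \<i>) has_integral 2 * of_real pi * \<i> * u 0) {0..2 * pi}"
    unfolding circlepath_def by (subst (asm) has_contour_integral_part_circlepath_iff) auto
  from has_integral_mult_left[OF this, of "- \<i>"] show ?thesis
    by (simp add: mult_ac)
qed

lemma submean_value_circle:
  assumes u: "u holomorphic_on A" and A: "cball 0 1 \<subseteq> A"
  shows "ennreal (2 * pi) * ennreal ((cmod (u 0))\<^sup>2)
    \<le> (\<integral>\<^sup>+t\<in>{0..2*pi}. ennreal ((cmod (u (cis t)))\<^sup>2) \<partial>lborel)"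
proof -
  have "continuous_on {0..2*pi} (\<lambda>t. u (cis t))"
    using A by (intro continuous_on_compose2[OF holomorphic_on_imp_continuous_on[OF u]])
      (auto simp: cis_conv_exp intro!: continuous_intros)
  then have square: "(\<lambda>t. (cmod (u (cis t)))\<^sup>2) integrable_on {0..2*pi}"
    by (intro integrable_continuous_interval continuous_intros)
  have "((\<lambda>t. (u (cis t))\<^sup>2) has_integral of_real (2 * pi) * (u 0)\<^sup>2) {0..2*pi}"
    using u A by (intro mean_value_circle) (auto intro!: holomorphic_intros)
  then have "norm (of_real (2 * pi) * (u 0)\<^sup>2) \<le> integral {0..2*pi} (\<lambda>t. (cmod (u (cis t)))\<^sup>2)"
    using integral_norm_bound_integral[OF _ square, of "\<lambda>t. (u (cis t))\<^sup>2"]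
    by (auto simp: has_integral_integrable_integral norm_power)
  then have "ennreal (2 * pi * (cmod (u 0))\<^sup>2) \<le> ennreal (integral {0..2*pi} (\<lambda>t. (cmod (u (cis t)))\<^sup>2))"
    by (intro ennreal_leI) (simp add: norm_mult norm_power)
  also have "\<dots> = (\<integral>\<^sup>+t\<in>{0..2*pi}. ennreal ((cmod (u (cis t)))\<^sup>2) \<partial>lborel)"
    using square by (intro nn_integral_has_integral_lebesgue'[symmetric] integrable_integral) auto
  finally show ?thesis
    by (simp add: ennreal_mult)
qed

lemma borel_measurable_cmod_square_on_open:
  assumes "open D" "continuous_on D f"
  shows "(\<lambda>x. ennreal ((cmod (f x))\<^sup>2) * indicator D x) \<in> borel_measurable borel"
proof -
  have "(\<lambda>x. indicator D x *\<^sub>R (cmod (f x))\<^sup>2) \<in> borel_measurable borel"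
    using assms by (intro borel_measurable_continuous_on_indicator continuous_intros) auto
  then have "(\<lambda>x. ennreal (indicator D x *\<^sub>R (cmod (f x))\<^sup>2)) \<in> borel_measurable borel"
    by simp
  also have "(\<lambda>x. ennreal (indicator D x *\<^sub>R (cmod (f x))\<^sup>2)) = (\<lambda>x. ennreal ((cmod (f x))\<^sup>2) * indicator D x)"
    by (auto simp: indicator_def)
  finally show ?thesis .
qed

lemma cholo_on_submean_value_circle:
  assumes J: "complex_structure J" and f: "cholo_on J f D" and "open D"
    and disc: "\<And>\<mu>. cmod \<mu> \<le> 1 \<Longrightarrow> x + cscale J \<mu> v \<in> D"
  shows "ennreal (2 * pi) * ennreal ((cmod (f x))\<^sup>2)
    \<le> (\<integral>\<^sup>+t\<in>{0..2*pi}. ennreal ((cmod (f (x + cscale J (cis t) v)))\<^sup>2) \<partial>lborel)"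
proof -
  let ?A = "(\<lambda>\<mu>. x + cscale J \<mu> v) -` D"
  have "open ?A"
    using \<open>open D\<close> by (intro open_vimage continuous_intros continuous_on_cscale[OF J])
  then have "(\<lambda>\<mu>. f (x + cscale J \<mu> v)) holomorphic_on ?A"
    using f by (intro holomorphic_on_cscale_line) auto
  moreover have "cball 0 1 \<subseteq> ?A"
    using disc by auto
  ultimately show ?thesis
    using submean_value_circle[of "\<lambda>\<mu>. f (x + cscale J \<mu> v)"] by (simp add: cscale_def)
qed

lemma cholo_on_submean_value_ball:
  fixes J :: "'a::euclidean_space \<Rightarrow> 'a"
  assumes J: "complex_structure J" and f: "cholo_on J f (ball x r)"
  shows "ennreal ((cmod (f x))\<^sup>2) * emeasure lborel (ball x r)
    \<le> (\<integral>\<^sup>+y\<in>ball x r. ennreal ((cmod (f y))\<^sup>2) \<partial>lborel)"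
proof -
  define H where "H y = ennreal ((cmod (f y))\<^sup>2) * indicator (ball x r) y" for y
  have H[measurable]: "H \<in> borel_measurable borel"
    unfolding H_def using f by (intro borel_measurable_cmod_square_on_open cholo_on_imp_continuous_on) auto
  have circle: "ennreal (2 * pi) * ennreal ((cmod (f x))\<^sup>2) * indicator (ball 0 r) v
      \<le> (\<integral>\<^sup>+t\<in>{0..2*pi}. H (x + cscale J (cis t) v) \<partial>lborel)" for v
  proof (cases "v \<in> ball 0 r")
    case True
    have disc: "x + cscale J \<mu> v \<in> ball x r" if "cmod \<mu> \<le> 1" for \<mu>
      using mult_right_mono[OF that norm_ge_zero[of v]] True by (simp add: dist_norm norm_cscale[OF J])
    then have "H (x + cscale J (cis t) v) = ennreal ((cmod (f (x + cscale J (cis t) v)))\<^sup>2)" for t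
      by (simp add: H_def)
    then show ?thesis
      using cholo_on_submean_value_circle[OF J f open_ball disc] True by simp
  qed simp
  have "indicator (ball x r) (x + v) = (indicator (ball 0 r) v :: ennreal)" for v
    by (simp add: indicator_def dist_norm)
  then have shift: "emeasure lborel (ball x r) = emeasure lborel (ball (0::'a) r)"
    using nn_integral_lborel_plus[of "indicator (ball x r)" x, OF borel_measurable_indicator] by simp
  have "ennreal (2 * pi) * (ennreal ((cmod (f x))\<^sup>2) * emeasure lborel (ball x r))
      = (\<integral>\<^sup>+v. ennreal (2 * pi) * ennreal ((cmod (f x))\<^sup>2) * indicator (ball (0::'a) r) v \<partial>lborel)"
    by (simp add: nn_integral_cmult_indicator shift flip: mult.assoc)
  also have "\<dots> \<le> (\<integral>\<^sup>+v. (\<integral>\<^sup>+t\<in>{0..2*pi}. H (x + cscale J (cis t) v) \<partial>lborel) \<partial>lborel)"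
    by (intro nn_integral_mono circle)
  also have "\<dots> = ennreal (2 * pi - 0) * (\<integral>\<^sup>+v. H (x + v) \<partial>lborel)"
    by (rule nn_integral_isometry_average)
      (auto simp: linear_cscale[OF J] norm_cscale[OF J] cis_conv_exp
        intro!: continuous_on_cscale[OF J] continuous_intros)
  also have "\<dots> = ennreal (2 * pi) * (\<integral>\<^sup>+y. H y \<partial>lborel)"
    by (simp add: nn_integral_lborel_plus)
  finally show ?thesis
    unfolding H_def by (simp add: ennreal_mult_le_mult_iff)
qed

lemma cholo_on_Cauchy_inequality:
  assumes J: "complex_structure J" and f: "cholo_on J f D" and cball: "cball x r \<subseteq> D" and "r > 0"
    and L: "(f has_derivative L) (at x)" "\<And>v. L (J v) = \<i> * L v"
    and bound: "\<And>y. y \<in> cball x r \<Longrightarrow> cmod (f y) \<le> B"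
  shows "cmod (L v) \<le> B / r * norm v"
proof (cases "v = 0")
  case True
  then show ?thesis
    using has_derivative_linear[OF L(1)] by (simp add: linear_0)
next
  case False
  define \<rho> where "\<rho> = r / norm v"
  have "\<rho> > 0"
    using False \<open>r > 0\<close> by (simp add: \<rho>_def)
  define h where "h \<mu> = f (x + cscale J \<mu> v)" for \<mu>
  have in_cball: "x + cscale J \<mu> v \<in> cball x r" if "cmod \<mu> \<le> \<rho>" for \<mu>
    using that False by (simp add: dist_norm norm_cscale[OF J] \<rho>_def field_simps)
  have "norm ((deriv ^^ 1) h 0) \<le> fact 1 * B / \<rho> ^ 1"
  proof (rule Cauchy_inequality)
    show "h holomorphic_on ball 0 \<rho>"
      unfolding h_def using in_cball cball by (intro holomorphic_on_cscale_line[OF f]) auto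
    show "continuous_on (cball 0 \<rho>) h"
      unfolding h_def
      by (intro continuous_on_compose2[OF cholo_on_imp_continuous_on[OF f]] continuous_intros
          continuous_on_cscale[OF J])
        (use in_cball cball in auto)
    show "cmod (h \<mu>) \<le> B" if "cmod (0 - \<mu>) = \<rho>" for \<mu>
      unfolding h_def using that by (intro bound in_cball) simp
  qed fact
  moreover have "(h has_field_derivative L v) (at 0)"
    unfolding h_def using L by (intro has_field_derivative_cscale_line) (simp_all add: cscale_def)
  ultimately show ?thesis
    using False \<open>r > 0\<close> by (simp add: DERIV_imp_deriv \<rho>_def field_simps)
qed

lemma has_derivative_uniform_limit_blinfun:
  fixes F :: "nat \<Rightarrow> 'a::real_normed_vector \<Rightarrow> 'b::banach"
  assumes "convex S" and deriv: "\<And>n y. y \<in> S \<Longrightarrow> (F n has_derivative blinfun_apply (L n y)) (at y within S)"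
    and L: "uniform_limit S L g' sequentially"
    and F: "\<And>y. y \<in> S \<Longrightarrow> (\<lambda>n. F n y) \<longlonglongrightarrow> g y" and "x \<in> S"
  shows "(g has_derivative blinfun_apply (g' x)) (at x within S)"
proof -
  have "\<exists>G. \<forall>y\<in>S. (\<lambda>n. F n y) \<longlonglongrightarrow> G y \<and> (G has_derivative blinfun_apply (g' y)) (at y within S)"
  proof (rule has_derivative_sequence[OF \<open>convex S\<close> deriv _ \<open>x \<in> S\<close> F[OF \<open>x \<in> S\<close>]])
    fix e :: real assume "e > 0"
    have "norm (blinfun_apply (L n y) h - blinfun_apply (g' y) h) \<le> e * norm h"
      if "dist (L n y) (g' y) < e" for n y h
    proof -
      have "norm (blinfun_apply (L n y) h - blinfun_apply (g' y) h) \<le> norm (L n y - g' y) * norm h"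
        using norm_blinfun[of "L n y - g' y" h] by (simp add: blinfun.diff_left)
      also have "\<dots> \<le> e * norm h"
        using that by (intro mult_right_mono) (auto simp: dist_norm)
      finally show ?thesis .
    qed
    with uniform_limitD[OF L \<open>e > 0\<close>]
    show "\<forall>\<^sub>F n in sequentially. \<forall>y\<in>S. \<forall>h.
        norm (blinfun_apply (L n y) h - blinfun_apply (g' y) h) \<le> e * norm h"
      by (auto elim: eventually_mono)
  qed
  then obtain G where G: "\<And>y. y \<in> S \<Longrightarrow> (\<lambda>n. F n y) \<longlonglongrightarrow> G y"
    "(G has_derivative blinfun_apply (g' x)) (at x within S)"
    using \<open>x \<in> S\<close> by blast
  moreover have "G y = g y" if "y \<in> S" for y
    using G(1) F that LIMSEQ_unique by blast
  ultimately show ?thesis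
    using \<open>x \<in> S\<close> by (metis has_derivative_transform)
qed

lemma norm_cholo_derivative_diff_le:
  assumes J: "complex_structure J" and f: "cholo_on J f D" and g: "cholo_on J g D"
    and cball: "cball x r \<subseteq> D" and "r > 0" and "B \<ge> 0"
    and L: "(f has_derivative blinfun_apply L) (at x)" "\<And>v. blinfun_apply L (J v) = \<i> * blinfun_apply L v"
    and M: "(g has_derivative blinfun_apply M) (at x)" "\<And>v. blinfun_apply M (J v) = \<i> * blinfun_apply M v"
    and bound: "\<And>y. y \<in> cball x r \<Longrightarrow> cmod (f y - g y) \<le> B"
  shows "norm (L - M) \<le> B / r"
proof (rule norm_blinfun_bound)
  fix v
  have deriv: "((\<lambda>y. f y + (- 1) * g y) has_derivative blinfun_apply (L - M)) (at x)"
    using has_derivative_diff[OF L(1) M(1)] by (simp add: minus_blinfun.rep_eq)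
  have "cholo_on J (\<lambda>y. f y + (- 1) * g y) D"
    by (intro cholo_on_add cholo_on_mult cholo_on_const f g)
  then show "cmod (blinfun_apply (L - M) v) \<le> B / r * norm v"
    by (rule cholo_on_Cauchy_inequality[OF J _ cball \<open>r > 0\<close> deriv])
      (simp_all add: L(2) M(2) bound blinfun.diff_left right_diff_distrib)
qed (use \<open>r > 0\<close> \<open>B \<ge> 0\<close> in simp)

lemma uniformly_Cauchy_on_cholo_derivatives:
  assumes J: "complex_structure J" and F: "\<And>n. cholo_on J (F n) D"
    and r: "r > 0" "cball x r \<subseteq> D" and Cauchy: "uniformly_Cauchy_on (cball x r) F"
    and L: "\<And>n y. y \<in> D \<Longrightarrow> (F n has_derivative blinfun_apply (L n y)) (at y)"
      "\<And>n y v. y \<in> D \<Longrightarrow> blinfun_apply (L n y) (J v) = \<i> * blinfun_apply (L n y) v"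
  shows "uniformly_Cauchy_on (ball x (r / 2)) L"
proof (rule uniformly_Cauchy_onI)
  fix e :: real assume "e > 0"
  then have "e * r / 4 > 0"
    using r by simp
  then obtain N where N: "\<And>m n y. m \<ge> N \<Longrightarrow> n \<ge> N \<Longrightarrow> y \<in> cball x r \<Longrightarrow> cmod (F m y - F n y) < e * r / 4"
    using Cauchy unfolding uniformly_Cauchy_on_def dist_norm by metis
  have "dist (L m y) (L n y) < e" if y: "y \<in> ball x (r / 2)" and "m \<ge> N" "n \<ge> N" for y m n
  proof -
    have sub: "cball y (r / 2) \<subseteq> cball x r"
      using y by (simp add: cball_subset_cball_iff dist_commute)
    have "y \<in> D"
      using y r by (auto simp: subset_iff)
    have "norm (L m y - L n y) \<le> (e * r / 4) / (r / 2)"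
    proof (rule norm_cholo_derivative_diff_le[OF J F F _ _ _ L L, OF _ _ _ \<open>y \<in> D\<close> \<open>y \<in> D\<close> \<open>y \<in> D\<close> \<open>y \<in> D\<close>])
      show "cball y (r / 2) \<subseteq> D"
        using sub r by blast
      show "cmod (F m z - F n z) \<le> e * r / 4" if "z \<in> cball y (r / 2)" for z
        using N[of m n z] sub that \<open>m \<ge> N\<close> \<open>n \<ge> N\<close> by (simp add: less_imp_le subset_iff)
    qed (use \<open>e > 0\<close> r in simp_all)
    also have "\<dots> < e"
      using \<open>e > 0\<close> r by simp
    finally show ?thesis
      by (simp add: dist_norm)
  qed
  then show "\<exists>M. \<forall>y\<in>ball x (r / 2). \<forall>m\<ge>M. \<forall>n\<ge>M. dist (L m y) (L n y) < e"
    by blast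
qed

lemma cholo_on_blinfun_derivative:
  assumes "cholo_on J f D"
  shows "\<exists>L. \<forall>x\<in>D. (f has_derivative blinfun_apply (L x)) (at x) \<and>
    (\<forall>v. blinfun_apply (L x) (J v) = \<i> * blinfun_apply (L x) v)"
  using assms unfolding cholo_on_def
  by (intro bchoice) (metis bounded_linear_Blinfun_apply has_derivative_bounded_linear)

lemma cholo_on_uniform_sequence:
  assumes J: "complex_structure J" and F: "\<And>n. cholo_on J (F n) D"
    and unif: "\<And>x. x \<in> D \<Longrightarrow> \<exists>r>0. cball x r \<subseteq> D \<and> uniform_limit (cball x r) F g sequentially"
  shows "cholo_on J g D"
  unfolding cholo_on_def
proof
  fix x assume "x \<in> D"
  then obtain r where r: "r > 0" "cball x r \<subseteq> D" and g: "uniform_limit (cball x r) F g sequentially"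
    using unif by blast
  let ?B = "ball x (r / 2)"
  have B: "x \<in> ?B" "?B \<subseteq> cball x r" "?B \<subseteq> D"
    using r by auto
  obtain L where L: "\<And>n y. y \<in> D \<Longrightarrow> (F n has_derivative blinfun_apply (L n y)) (at y)"
    "\<And>n y v. y \<in> D \<Longrightarrow> blinfun_apply (L n y) (J v) = \<i> * blinfun_apply (L n y) v"
    by (metis cholo_on_blinfun_derivative[OF F])
  have "uniformly_Cauchy_on (cball x r) F"
    using g by (intro uniformly_convergent_Cauchy uniformly_convergentI)
  from uniformly_Cauchy_on_cholo_derivatives[OF J F r this L]
  obtain g' where g': "uniform_limit ?B L g' sequentially"
    using Cauchy_uniformly_convergent unfolding uniformly_convergent_on_def by blast
  have "(g has_derivative blinfun_apply (g' x)) (at x within ?B)"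
  proof (rule has_derivative_uniform_limit_blinfun[OF convex_ball _ g' _ B(1)])
    show "(F n has_derivative blinfun_apply (L n y)) (at y within ?B)" if "y \<in> ?B" for n y
      using L(1) that B(3) by (blast intro: has_derivative_at_withinI)
    show "(\<lambda>n. F n y) \<longlonglongrightarrow> g y" if "y \<in> ?B" for y
      using that B(2) by (blast intro: tendsto_uniform_limitI[OF g])
  qed
  then have "(g has_derivative blinfun_apply (g' x)) (at x)"
    using B(1) by (simp add: at_within_open[OF _ open_ball])
  moreover have "blinfun_apply (g' x) (J v) = \<i> * blinfun_apply (g' x) v" for v
  proof (rule LIMSEQ_unique)
    have limit: "(\<lambda>n. L n x) \<longlonglongrightarrow> g' x"
      using B(1) by (rule tendsto_uniform_limitI[OF g'])
    show "(\<lambda>n. blinfun_apply (L n x) (J v)) \<longlonglongrightarrow> blinfun_apply (g' x) (J v)"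
      by (intro tendsto_intros limit)
    show "(\<lambda>n. blinfun_apply (L n x) (J v)) \<longlonglongrightarrow> \<i> * blinfun_apply (g' x) v"
      unfolding L(2)[OF \<open>x \<in> D\<close>] by (intro tendsto_intros limit)
  qed
  ultimately show "\<exists>L. (g has_derivative L) (at x) \<and> (\<forall>v. L (J v) = \<i> * L v)"
    by blast
qed

section \<open>The Bergman space\<close>

definition L2_inner :: "'a::euclidean_space set \<Rightarrow> ('a \<Rightarrow> complex) \<Rightarrow> ('a \<Rightarrow> complex) \<Rightarrow> complex" where
  "L2_inner D f g = (LINT x:D|lborel. f x * cnj (g x))"

definition L2_norm2 :: "'a::euclidean_space set \<Rightarrow> ('a \<Rightarrow> complex) \<Rightarrow> real" where
  "L2_norm2 D f = (LINT x:D|lborel. (cmod (f x))\<^sup>2)"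

lemma L2_norm2_nonneg: "L2_norm2 D f \<ge> 0"
  unfolding L2_norm2_def set_lebesgue_integral_def by (intro integral_nonneg_AE) auto

lemma L2_inner_self: "L2_inner D f f = of_real (L2_norm2 D f)"
  unfolding L2_inner_def L2_norm2_def
  by (simp add: complex_norm_square[symmetric] del: of_real_power flip: set_integral_complex_of_real)

lemma cnj_L2_inner: "cnj (L2_inner D f g) = L2_inner D g f"
  unfolding L2_inner_def set_lebesgue_integral_def
  by (simp flip: Bochner_Integration.integral_cnj add: mult.commute)

lemma L2_inner_cmult_left: "L2_inner D (\<lambda>x. c * f x) g = c * L2_inner D f g"
  unfolding L2_inner_def by (simp add: mult.assoc)

lemma L2_inner_cmult_right: "L2_inner D f (\<lambda>x. c * g x) = cnj c * L2_inner D f g"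
  using L2_inner_cmult_left[of D c g f] by (metis complex_cnj_mult cnj_L2_inner)

lemma L2_norm2_cmult: "L2_norm2 D (\<lambda>x. c * f x) = (cmod c)\<^sup>2 * L2_norm2 D f"
  by (simp add: L2_norm2_def norm_mult power_mult_distrib)

lemma L2_inner_cong:
  assumes "\<And>x. x \<in> D \<Longrightarrow> f x = f' x" "\<And>x. x \<in> D \<Longrightarrow> g x = g' x"
  shows "L2_inner D f g = L2_inner D f' g'"
  unfolding L2_inner_def set_lebesgue_integral_def
  by (intro Bochner_Integration.integral_cong) (auto simp: assms indicator_def)

lemma
  fixes f :: "'a::euclidean_space \<Rightarrow> 'b::{banach, second_countable_topology}"
  assumes "open D" "continuous_on D f"
  shows set_integrable_lebesgue_iff_lborel: "set_integrable lebesgue D f \<longleftrightarrow> set_integrable lborel D f"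
    and set_integral_lebesgue_eq_lborel: "(LINT x:D|lebesgue. f x) = (LINT x:D|lborel. f x)"
proof -
  have "(\<lambda>x. indicator D x *\<^sub>R f x) \<in> borel_measurable lborel"
    using assms borel_measurable_continuous_on_indicator[of D f] by simp
  then show "set_integrable lebesgue D f \<longleftrightarrow> set_integrable lborel D f"
    and "(LINT x:D|lebesgue. f x) = (LINT x:D|lborel. f x)"
    unfolding set_integrable_def set_lebesgue_integral_def
    using integrable_completion integral_completion by blast+
qed

context
  fixes D :: "'a::euclidean_space set" and J :: "'a \<Rightarrow> 'a"
  assumes D: "open D"
begin

lemma A2_cholo_on: "f \<in> A2 J D \<Longrightarrow> cholo_on J f D"
  by (simp add: A2_def)

lemma A2_continuous_on: "f \<in> A2 J D \<Longrightarrow> continuous_on D f"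
  using A2_cholo_on cholo_on_imp_continuous_on by blast

lemma A2_iff_set_integrable: "f \<in> A2 J D \<longleftrightarrow> cholo_on J f D \<and> set_integrable lborel D (\<lambda>x. (cmod (f x))\<^sup>2)"
proof -
  have "continuous_on D (\<lambda>x. (cmod (f x))\<^sup>2)" if "cholo_on J f D"
    using that by (intro continuous_intros cholo_on_imp_continuous_on)
  then show ?thesis
    unfolding A2_def using set_integrable_lebesgue_iff_lborel[OF D] by blast
qed

lemma nn_integral_A2:
  assumes "f \<in> A2 J D"
  shows "(\<integral>\<^sup>+x\<in>D. ennreal ((cmod (f x))\<^sup>2) \<partial>lborel) = ennreal (L2_norm2 D f)"
proof -
  have "(\<integral>\<^sup>+x\<in>D. ennreal ((cmod (f x))\<^sup>2) \<partial>lborel)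
      = (\<integral>\<^sup>+x. ennreal (indicator D x *\<^sub>R (cmod (f x))\<^sup>2) \<partial>lborel)"
    by (intro nn_integral_cong) (simp add: indicator_def)
  also have "\<dots> = ennreal (L2_norm2 D f)"
    unfolding L2_norm2_def set_lebesgue_integral_def using assms
    by (intro nn_integral_eq_integral) (auto simp: A2_iff_set_integrable set_integrable_def)
  finally show ?thesis .
qed

lemma A2_iff_nn_integral: "f \<in> A2 J D \<longleftrightarrow> cholo_on J f D \<and> (\<integral>\<^sup>+x\<in>D. ennreal ((cmod (f x))\<^sup>2) \<partial>lborel) < \<infinity>"
proof
  assume "f \<in> A2 J D"
  then show "cholo_on J f D \<and> (\<integral>\<^sup>+x\<in>D. ennreal ((cmod (f x))\<^sup>2) \<partial>lborel) < \<infinity>"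
    by (simp add: A2_cholo_on nn_integral_A2)
next
  assume f: "cholo_on J f D \<and> (\<integral>\<^sup>+x\<in>D. ennreal ((cmod (f x))\<^sup>2) \<partial>lborel) < \<infinity>"
  then have "continuous_on D (\<lambda>x. (cmod (f x))\<^sup>2)"
    by (intro continuous_intros cholo_on_imp_continuous_on[of J]) simp
  then have "(\<lambda>x. indicator D x *\<^sub>R (cmod (f x))\<^sup>2) \<in> borel_measurable lborel"
    using D borel_measurable_continuous_on_indicator[of D "\<lambda>x. (cmod (f x))\<^sup>2"] by simp
  moreover have "ennreal (norm (indicator D x *\<^sub>R (cmod (f x))\<^sup>2)) = ennreal ((cmod (f x))\<^sup>2) * indicator D x"
    for x
    by (simp add: indicator_def)
  ultimately show "f \<in> A2 J D"
    using f by (simp add: A2_iff_set_integrable set_integrable_def integrable_iff_bounded)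
qed

lemma A2_cong:
  assumes "\<And>x. x \<in> D \<Longrightarrow> f x = g x" and f: "f \<in> A2 J D"
  shows "g \<in> A2 J D"
proof -
  have "cholo_on J g D"
    using cholo_on_cong[OF D assms(1) A2_cholo_on[OF f]] by simp
  moreover have "(\<integral>\<^sup>+x\<in>D. ennreal ((cmod (f x))\<^sup>2) \<partial>lborel) = (\<integral>\<^sup>+x\<in>D. ennreal ((cmod (g x))\<^sup>2) \<partial>lborel)"
    using assms(1) by (intro nn_integral_cong) (auto simp: indicator_def)
  ultimately show ?thesis
    using f by (simp add: A2_iff_nn_integral)
qed

lemma A2_mult_integrable:
  assumes f: "f \<in> A2 J D" and g: "g \<in> A2 J D"
  shows "set_integrable lborel D (\<lambda>x. f x * cnj (g x))"
proof (rule set_integrable_bound)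
  show "set_integrable lborel D (\<lambda>x. (cmod (f x))\<^sup>2 + (cmod (g x))\<^sup>2)"
    using f g by (auto simp: A2_iff_set_integrable)
  show "set_borel_measurable lborel D (\<lambda>x. f x * cnj (g x))"
    using D A2_continuous_on[OF f] A2_continuous_on[OF g] unfolding set_borel_measurable_def measurable_lborel2
    by (intro borel_measurable_continuous_on_indicator continuous_intros) auto
  have "cmod (f x) * cmod (g x) \<le> (cmod (f x))\<^sup>2 + (cmod (g x))\<^sup>2" for x
    using sum_squares_bound[of "cmod (f x)" "cmod (g x)"]
      mult_nonneg_nonneg[OF norm_ge_zero norm_ge_zero, of "f x" "g x"]
    by linarith
  then show "AE x in lborel. x \<in> D \<longrightarrow> norm (f x * cnj (g x)) \<le> norm ((cmod (f x))\<^sup>2 + (cmod (g x))\<^sup>2)"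
    by (auto simp: norm_mult)
qed

lemma L2_inner_lebesgue:
  assumes "f \<in> A2 J D" "g \<in> A2 J D"
  shows "(LINT x:D|lebesgue. f x * cnj (g x)) = L2_inner D f g"
  unfolding L2_inner_def using assms A2_continuous_on
  by (intro set_integral_lebesgue_eq_lborel[OF D] continuous_intros) auto

lemma A2_zero: "(\<lambda>x. 0) \<in> A2 J D"
  by (simp add: A2_iff_nn_integral cholo_on_const)

lemma A2_cmult: "f \<in> A2 J D \<Longrightarrow> (\<lambda>x. c * f x) \<in> A2 J D"
  by (auto simp: A2_iff_set_integrable cholo_on_mult cholo_on_const norm_mult power_mult_distrib)

lemma A2_add:
  assumes f: "f \<in> A2 J D" and g: "g \<in> A2 J D"
  shows "(\<lambda>x. f x + g x) \<in> A2 J D"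
proof -
  have bound: "(cmod (f x + g x))\<^sup>2 \<le> 2 * (cmod (f x))\<^sup>2 + 2 * (cmod (g x))\<^sup>2" for x
  proof -
    have "(cmod (f x + g x))\<^sup>2 \<le> (cmod (f x) + cmod (g x))\<^sup>2"
      by (intro power_mono norm_triangle_ineq) auto
    also have "\<dots> \<le> 2 * (cmod (f x))\<^sup>2 + 2 * (cmod (g x))\<^sup>2"
      using sum_squares_bound[of "cmod (f x)" "cmod (g x)"] by (simp add: power2_sum)
    finally show ?thesis .
  qed
  have "set_integrable lborel D (\<lambda>x. (cmod (f x + g x))\<^sup>2)"
  proof (rule set_integrable_bound)
    show "set_integrable lborel D (\<lambda>x. 2 * (cmod (f x))\<^sup>2 + 2 * (cmod (g x))\<^sup>2)"
      using f g by (auto simp: A2_iff_set_integrable)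
    show "set_borel_measurable lborel D (\<lambda>x. (cmod (f x + g x))\<^sup>2)"
      using D A2_continuous_on[OF f] A2_continuous_on[OF g] unfolding set_borel_measurable_def measurable_lborel2
      by (intro borel_measurable_continuous_on_indicator continuous_intros) auto
  qed (use bound in auto)
  then show ?thesis
    using f g by (simp add: A2_iff_set_integrable cholo_on_add)
qed

lemma L2_inner_add_left:
  "f \<in> A2 J D \<Longrightarrow> g \<in> A2 J D \<Longrightarrow> h \<in> A2 J D \<Longrightarrow> L2_inner D (\<lambda>x. f x + g x) h = L2_inner D f h + L2_inner D g h"
  unfolding L2_inner_def by (simp add: ring_distribs set_integral_add A2_mult_integrable)

lemma L2_norm2_add_cmult:
  assumes f: "f \<in> A2 J D" and g: "g \<in> A2 J D"
  shows "L2_norm2 D (\<lambda>x. f x + c * g x) =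
    L2_norm2 D f + 2 * Re (c * L2_inner D g f) + (cmod c)\<^sup>2 * L2_norm2 D g"
proof -
  let ?s = "\<lambda>x. f x + c * g x"
  have cg: "(\<lambda>x. c * g x) \<in> A2 J D" and s: "?s \<in> A2 J D"
    using f g by (auto intro: A2_add A2_cmult)
  have expand: "L2_inner D h ?s = L2_inner D h f + cnj c * L2_inner D h g" if "h \<in> A2 J D" for h
  proof -
    have "L2_inner D h ?s = cnj (L2_inner D ?s h)"
      by (simp add: cnj_L2_inner)
    also have "\<dots> = L2_inner D h f + cnj c * L2_inner D h g"
      using L2_inner_add_left[OF f cg that] by (simp add: L2_inner_cmult_left cnj_L2_inner)
    finally show ?thesis .
  qed
  have "of_real (L2_norm2 D ?s) = L2_inner D f ?s + c * L2_inner D g ?s"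
    using L2_inner_add_left[OF f cg s] by (simp add: L2_inner_self[symmetric] L2_inner_cmult_left)
  also have "\<dots> = of_real (L2_norm2 D f) + (c * L2_inner D g f + cnj (c * L2_inner D g f)) +
      c * cnj c * of_real (L2_norm2 D g)"
    by (simp add: expand f g L2_inner_self cnj_L2_inner algebra_simps)
  also have "\<dots> = of_real (L2_norm2 D f + 2 * Re (c * L2_inner D g f) + (cmod c)\<^sup>2 * L2_norm2 D g)"
    by (simp add: complex_add_cnj complex_norm_square[symmetric] del: complex_cnj_mult)
  finally show ?thesis
    using of_real_eq_iff by blast
qed

lemma L2_norm2_parallelogram:
  assumes "f \<in> A2 J D" "g \<in> A2 J D"
  shows "L2_norm2 D (\<lambda>x. f x - g x) = 2 * L2_norm2 D f + 2 * L2_norm2 D g - L2_norm2 D (\<lambda>x. f x + g x)"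
  using L2_norm2_add_cmult[OF assms, of "- 1"] L2_norm2_add_cmult[OF assms, of 1] by simp

lemma A2_point_evaluation_bound:
  assumes J: "complex_structure J" and f: "f \<in> A2 J D" and ball: "ball x r \<subseteq> D"
  shows "(cmod (f x))\<^sup>2 * measure lborel (ball x r) \<le> L2_norm2 D f"
proof -
  have "ennreal ((cmod (f x))\<^sup>2 * measure lborel (ball x r))
      = ennreal ((cmod (f x))\<^sup>2) * emeasure lborel (ball x r)"
    using emeasure_lborel_ball_finite[of x r] by (simp add: ennreal_mult emeasure_eq_ennreal_measure)
  also have "\<dots> \<le> (\<integral>\<^sup>+y\<in>ball x r. ennreal ((cmod (f y))\<^sup>2) \<partial>lborel)"
    using cholo_on_subset[OF A2_cholo_on[OF f] ball] by (rule cholo_on_submean_value_ball[OF J])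
  also have "\<dots> \<le> (\<integral>\<^sup>+y\<in>D. ennreal ((cmod (f y))\<^sup>2) \<partial>lborel)"
    using ball by (intro nn_set_integral_set_mono) auto
  finally show ?thesis
    by (simp add: nn_integral_A2[OF f] L2_norm2_nonneg)
qed

lemma L2_norm2_pos:
  assumes "complex_structure J" "f \<in> A2 J D" "x \<in> D" "f x \<noteq> 0"
  shows "L2_norm2 D f > 0"
proof -
  obtain r where r: "r > 0" "ball x r \<subseteq> D"
    using D \<open>x \<in> D\<close> open_contains_ball by blast
  have "0 < (cmod (f x))\<^sup>2 * measure lborel (ball x r)"
    using \<open>f x \<noteq> 0\<close> content_ball_pos[OF r(1)] by simp
  also have "\<dots> \<le> L2_norm2 D f"
    using assms(1,2) r(2) by (rule A2_point_evaluation_bound)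
  finally show ?thesis .
qed

lemma uniformly_Cauchy_on_A2:
  assumes J: "complex_structure J" and F: "\<And>n. F n \<in> A2 J D"
    and Cauchy: "\<And>e. e > 0 \<Longrightarrow> \<exists>N. \<forall>m\<ge>N. \<forall>n\<ge>N. L2_norm2 D (\<lambda>x. F m x - F n x) < e"
    and r: "r > 0" "ball x (2 * r) \<subseteq> D"
  shows "uniformly_Cauchy_on (cball x r) F"
proof (rule uniformly_Cauchy_onI)
  fix e :: real assume "e > 0"
  define c where "c = measure lborel (ball (0::'a) r)"
  have "c > 0"
    unfolding c_def using r by (intro content_ball_pos)
  then obtain N where N: "\<And>m n. m \<ge> N \<Longrightarrow> n \<ge> N \<Longrightarrow> L2_norm2 D (\<lambda>x. F m x - F n x) < e\<^sup>2 * c"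
    using Cauchy[of "e\<^sup>2 * c"] \<open>e > 0\<close> by auto
  have "dist (F m y) (F n y) < e" if y: "y \<in> cball x r" and "m \<ge> N" "n \<ge> N" for y m n
  proof -
    have "ball y r \<subseteq> ball x (2 * r)"
      using y by (intro ball_subset_ball_iff[THEN iffD2] disjI1) (simp add: dist_commute)
    then have "ball y r \<subseteq> D"
      using r by blast
    moreover have "(\<lambda>x. F m x + (- 1) * F n x) \<in> A2 J D"
      by (intro A2_add A2_cmult F)
    moreover have "measure lborel (ball y r) = c"
      using r unfolding c_def by (simp add: content_ball)
    ultimately have "(cmod (F m y - F n y))\<^sup>2 * c \<le> L2_norm2 D (\<lambda>x. F m x - F n x)"
      using A2_point_evaluation_bound[OF J, of "\<lambda>x. F m x + (- 1) * F n x" y r] by simp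
    also have "\<dots> < e\<^sup>2 * c"
      using N that by simp
    finally show ?thesis
      using \<open>c > 0\<close> \<open>e > 0\<close> by (simp add: dist_norm power_less_imp_less_base)
  qed
  then show "\<exists>M. \<forall>y\<in>cball x r. \<forall>m\<ge>M. \<forall>n\<ge>M. dist (F m y) (F n y) < e"
    by blast
qed

lemma A2_pointwise_limit:
  assumes F: "\<And>n. F n \<in> A2 J D" and lim: "(\<lambda>n. L2_norm2 D (F n)) \<longlonglongrightarrow> d"
    and g: "cholo_on J g D" "\<And>x. x \<in> D \<Longrightarrow> (\<lambda>n. F n x) \<longlonglongrightarrow> g x"
  shows "g \<in> A2 J D" "L2_norm2 D g \<le> d"
proof -
  let ?u = "\<lambda>f x. ennreal ((cmod (f x))\<^sup>2) * indicator D x"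
  have "(\<lambda>n. ?u (F n) x) \<longlonglongrightarrow> ?u g x" for x
    using g(2)[of x] by (cases "x \<in> D") (auto intro!: tendsto_intros)
  then have "(\<integral>\<^sup>+x. ?u g x \<partial>lborel) = (\<integral>\<^sup>+x. liminf (\<lambda>n. ?u (F n) x) \<partial>lborel)"
    by (intro nn_integral_cong lim_imp_Liminf[symmetric]) auto
  also have "\<dots> \<le> liminf (\<lambda>n. \<integral>\<^sup>+x. ?u (F n) x \<partial>lborel)"
    using borel_measurable_cmod_square_on_open[OF D A2_continuous_on[OF F]] by (intro nn_integral_liminf) simp
  also have "\<dots> = ennreal d"
    unfolding nn_integral_A2[OF F] by (intro lim_imp_Liminf tendsto_intros lim) simp
  finally have square_integral_le: "(\<integral>\<^sup>+x\<in>D. ennreal ((cmod (g x))\<^sup>2) \<partial>lborel) \<le> ennreal d" .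
  then show g_A2: "g \<in> A2 J D"
    using g(1) by (auto simp: A2_iff_nn_integral intro: le_less_trans)
  have "d \<ge> 0"
    using lim by (rule LIMSEQ_le_const) (simp add: L2_norm2_nonneg)
  with square_integral_le show "L2_norm2 D g \<le> d"
    by (simp add: nn_integral_A2[OF g_A2])
qed

lemma A2_complete:
  assumes J: "complex_structure J" and F: "\<And>n. F n \<in> A2 J D"
    and Cauchy: "\<And>e. e > 0 \<Longrightarrow> \<exists>N. \<forall>m\<ge>N. \<forall>n\<ge>N. L2_norm2 D (\<lambda>x. F m x - F n x) < e"
    and lim: "(\<lambda>n. L2_norm2 D (F n)) \<longlonglongrightarrow> d"
  obtains g where "g \<in> A2 J D" "\<And>x. x \<in> D \<Longrightarrow> (\<lambda>n. F n x) \<longlonglongrightarrow> g x" "L2_norm2 D g \<le> d"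
proof -
  define g where "g x = lim (\<lambda>n. F n x)" for x
  have unif: "\<exists>r>0. cball x r \<subseteq> D \<and> uniform_limit (cball x r) F g sequentially" if "x \<in> D" for x
  proof -
    obtain r where r: "r > 0" "ball x r \<subseteq> D"
      using D \<open>x \<in> D\<close> open_contains_ball by blast
    then have "uniformly_convergent_on (cball x (r / 2)) F"
      using uniformly_Cauchy_on_A2[OF J F Cauchy, of "r / 2" x] by (simp add: Cauchy_uniformly_convergent)
    moreover have "cball x (r / 2) \<subseteq> ball x r"
      using r by auto
    ultimately show ?thesis
      using r unfolding uniformly_convergent_uniform_limit_iff g_def by (intro exI[of _ "r / 2"]) auto
  qed
  have pointwise: "(\<lambda>n. F n x) \<longlonglongrightarrow> g x" if "x \<in> D" for x
    using unif[OF that] by (auto intro: tendsto_uniform_limitI)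
  have "cholo_on J g D"
    using unif by (rule cholo_on_uniform_sequence[OF J A2_cholo_on[OF F]])
  then show thesis
    using A2_pointwise_limit[OF F lim] pointwise that by blast
qed

section \<open>The Bergman kernel\<close>

lemma A2_minimizing_sequence_Cauchy:
  assumes F: "\<And>n. F n \<in> A2 J D" "\<And>n. F n y = 1" and lim: "(\<lambda>n. L2_norm2 D (F n)) \<longlonglongrightarrow> d"
    and least: "\<And>f. f \<in> A2 J D \<Longrightarrow> f y = 1 \<Longrightarrow> d \<le> L2_norm2 D f" and "e > 0"
  shows "\<exists>N. \<forall>m\<ge>N. \<forall>n\<ge>N. L2_norm2 D (\<lambda>x. F m x - F n x) < e"
proof -
  have midpoint: "L2_norm2 D (\<lambda>x. F m x - F n x) \<le> 2 * (L2_norm2 D (F m) - d) + 2 * (L2_norm2 D (F n) - d)"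
    for m n
  proof -
    have "d \<le> L2_norm2 D (\<lambda>x. 1/2 * (F m x + F n x))"
      by (intro least A2_cmult A2_add F(1)) (simp add: F(2))
    then have "4 * d \<le> L2_norm2 D (\<lambda>x. F m x + F n x)"
      unfolding L2_norm2_cmult by (simp add: norm_divide power_divide)
    then show ?thesis
      using L2_norm2_parallelogram[OF F(1)[of m] F(1)[of n]] by simp
  qed
  obtain N where N: "\<And>n. n \<ge> N \<Longrightarrow> L2_norm2 D (F n) < d + e / 4"
    using order_tendstoD(2)[OF lim, of "d + e / 4"] \<open>e > 0\<close> by (auto simp: eventually_sequentially)
  have "L2_norm2 D (\<lambda>x. F m x - F n x) < e" if "m \<ge> N" "n \<ge> N" for m n
    using midpoint[of m n] N[OF that(1)] N[OF that(2)] by simp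
  then show ?thesis
    by blast
qed

lemma A2_least_norm_exists:
  assumes J: "complex_structure J" and y: "y \<in> D" and f: "f \<in> A2 J D" "f y \<noteq> 0"
  obtains g where "g \<in> A2 J D" "g y = 1" "\<And>h. h \<in> A2 J D \<Longrightarrow> h y = 1 \<Longrightarrow> L2_norm2 D g \<le> L2_norm2 D h"
proof -
  define C where "C = {f \<in> A2 J D. f y = 1}"
  define d where "d = Inf (L2_norm2 D ` C)"
  have "(\<lambda>x. inverse (f y) * f x) \<in> C"
    using f by (simp add: C_def A2_cmult)
  then have nonempty: "L2_norm2 D ` C \<noteq> {}"
    by blast
  have d_le: "d \<le> L2_norm2 D f" if "f \<in> C" for f
    unfolding d_def using that by (auto intro!: cInf_lower bdd_belowI[of _ 0] simp: L2_norm2_nonneg)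
  have "\<exists>f\<in>C. L2_norm2 D f < d + 1 / real (Suc n)" for n
    using cInf_lessD[OF nonempty, of "d + 1 / real (Suc n)"] by (auto simp: d_def)
  then obtain F where F: "\<And>n. F n \<in> C" "\<And>n. L2_norm2 D (F n) < d + 1 / real (Suc n)"
    by metis
  have F_A2: "F n \<in> A2 J D" and F_y: "F n y = 1" for n
    using F(1)[of n] by (simp_all add: C_def)
  have lim: "(\<lambda>n. L2_norm2 D (F n)) \<longlonglongrightarrow> d"
  proof (rule tendsto_sandwich)
    show "\<forall>\<^sub>F n in sequentially. d \<le> L2_norm2 D (F n)"
      using F(1) d_le by simp
    show "\<forall>\<^sub>F n in sequentially. L2_norm2 D (F n) \<le> d + 1 / real (Suc n)"
      using F(2) by (simp add: less_imp_le)
    show "(\<lambda>n. d + 1 / real (Suc n)) \<longlonglongrightarrow> d"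
      using tendsto_add[OF tendsto_const LIMSEQ_Suc[OF lim_1_over_n], of d] by simp
  qed simp
  have "\<exists>N. \<forall>m\<ge>N. \<forall>n\<ge>N. L2_norm2 D (\<lambda>x. F m x - F n x) < e" if "e > 0" for e
    using A2_minimizing_sequence_Cauchy[OF F_A2 F_y lim _ that] d_le by (simp add: C_def)
  from A2_complete[OF J F_A2 this lim]
  obtain g where g: "g \<in> A2 J D" "\<And>x. x \<in> D \<Longrightarrow> (\<lambda>n. F n x) \<longlonglongrightarrow> g x" "L2_norm2 D g \<le> d"
    by blast
  moreover have "g y = 1"
    using g(2)[OF y] by (simp add: F_y LIMSEQ_const_iff)
  ultimately show thesis
    using d_le by (intro that[of g]) (auto simp: C_def intro: order_trans)
qed

lemma A2_least_norm_orthogonal: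
  assumes g: "g \<in> A2 J D" and least: "\<And>f. f \<in> A2 J D \<Longrightarrow> f y = g y \<Longrightarrow> L2_norm2 D g \<le> L2_norm2 D f"
    and h: "h \<in> A2 J D" "h y = 0"
  shows "L2_inner D h g = 0"
proof (rule ccontr)
  define p where "p = L2_inner D h g"
  assume "L2_inner D h g \<noteq> 0"
  define \<epsilon> where "\<epsilon> = 1 / (L2_norm2 D h + 1)"
  have \<epsilon>: "\<epsilon> > 0" "\<epsilon> * L2_norm2 D h < 1"
    using L2_norm2_nonneg[of D h] by (auto simp: \<epsilon>_def field_simps)
  define t where "t = - of_real \<epsilon> * cnj p"
  have "L2_norm2 D g \<le> L2_norm2 D (\<lambda>x. g x + t * h x)"
    using g h by (intro least A2_add A2_cmult) auto
  then have "0 \<le> 2 * Re (t * p) + (cmod t)\<^sup>2 * L2_norm2 D h"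
    by (simp add: L2_norm2_add_cmult g h p_def)
  also have "t * p = - of_real (\<epsilon> * (cmod p)\<^sup>2)"
    by (simp add: t_def complex_norm_square mult_ac del: of_real_power)
  also have "(cmod t)\<^sup>2 = \<epsilon>\<^sup>2 * (cmod p)\<^sup>2"
    by (simp add: t_def norm_mult power_mult_distrib)
  finally have "2 * (\<epsilon> * (cmod p)\<^sup>2) \<le> (\<epsilon> * L2_norm2 D h) * (\<epsilon> * (cmod p)\<^sup>2)"
    by (simp add: power2_eq_square mult_ac)
  also have "\<dots> \<le> 1 * (\<epsilon> * (cmod p)\<^sup>2)"
    using \<epsilon> by (intro mult_right_mono) auto
  finally have "\<epsilon> * (cmod p)\<^sup>2 \<le> 0"
    by simp
  moreover have "\<epsilon> * (cmod p)\<^sup>2 > 0"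
    using \<epsilon> \<open>L2_inner D h g \<noteq> 0\<close> by (simp add: p_def)
  ultimately show False
    by simp
qed

definition reproducing_at :: "'a \<Rightarrow> ('a \<Rightarrow> complex) \<Rightarrow> bool" where
  "reproducing_at y k \<longleftrightarrow> k \<in> A2 J D \<and> (\<forall>f\<in>A2 J D. f y = L2_inner D f k)"

lemma reproducing_at_exists:
  assumes J: "complex_structure J" and y: "y \<in> D"
  shows "\<exists>k. reproducing_at y k"
proof (cases "\<forall>f\<in>A2 J D. f y = 0")
  case True
  then have "reproducing_at y (\<lambda>x. 0)"
    by (simp add: reproducing_at_def A2_zero L2_inner_def)
  then show ?thesis
    by blast
next
  case False
  then obtain g where g: "g \<in> A2 J D" "g y = 1"
    and least: "\<And>f. f \<in> A2 J D \<Longrightarrow> f y = 1 \<Longrightarrow> L2_norm2 D g \<le> L2_norm2 D f"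
    using A2_least_norm_exists[OF J y] by blast
  have pos: "L2_norm2 D g > 0"
    using L2_norm2_pos[OF J g(1) y] g(2) by simp
  define k where "k x = of_real (1 / L2_norm2 D g) * g x" for x
  have "f y = L2_inner D f k" if f: "f \<in> A2 J D" for f
  proof -
    have fy: "(\<lambda>x. (- f y) * g x) \<in> A2 J D"
      using g by (intro A2_cmult)
    have "0 = L2_inner D (\<lambda>x. f x + (- f y) * g x) g"
      using A2_least_norm_orthogonal[OF g(1), of y] least g(2) A2_add[OF f fy] by simp
    also have "\<dots> = L2_inner D f g - f y * of_real (L2_norm2 D g)"
      using L2_inner_add_left[OF f fy g(1)] L2_inner_cmult_left[of D "- f y" g g] by (simp add: L2_inner_self)
    finally have "L2_inner D f g = f y * of_real (L2_norm2 D g)"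
      by simp
    then show ?thesis
      using pos unfolding k_def by (subst L2_inner_cmult_right) simp
  qed
  moreover have "k \<in> A2 J D"
    unfolding k_def[abs_def] using g by (intro A2_cmult)
  ultimately show ?thesis
    unfolding reproducing_at_def by blast
qed

lemma reproducing_at_symmetric:
  assumes "reproducing_at y k" "reproducing_at x l"
  shows "k x = cnj (l y)"
  using assms unfolding reproducing_at_def by (metis cnj_L2_inner)

definition is_bergman_kernel :: "('a \<Rightarrow> 'a \<Rightarrow> complex) \<Rightarrow> bool" where
  "is_bergman_kernel K \<longleftrightarrow>
    (\<forall>x y. x \<notin> D \<or> y \<notin> D \<longrightarrow> K x y = 0) \<and> (\<forall>y\<in>D. reproducing_at y (\<lambda>x. K x y))"

lemma bergman_gen_eq_The: "bergman_gen J D = The is_bergman_kernel"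
proof -
  have "is_bergman_kernel K \<longleftrightarrow> (\<forall>x y. (x \<notin> D \<or> y \<notin> D) \<longrightarrow> K x y = 0) \<and>
      (\<forall>y\<in>D. (\<lambda>x. K x y) \<in> A2 J D \<and> (\<forall>f\<in>A2 J D. f y = (LINT x:D|lebesgue. f x * cnj (K x y))))" for K
    unfolding is_bergman_kernel_def reproducing_at_def by (auto simp: L2_inner_lebesgue)
  then show ?thesis
    unfolding bergman_gen_def by (rule arg_cong[where f = The, OF ext, symmetric])
qed

lemma is_bergman_kernel_unique:
  assumes "is_bergman_kernel K" "is_bergman_kernel K'"
  shows "K = K'"
proof (intro ext)
  fix x y
  show "K x y = K' x y"
  proof (cases "x \<in> D \<and> y \<in> D")
    case True
    then have "K x y = cnj (K y x)" "K' x y = cnj (K y x)"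
      using assms by (intro reproducing_at_symmetric; simp add: is_bergman_kernel_def)+
    then show ?thesis
      by simp
  next
    case False
    then show ?thesis
      using assms unfolding is_bergman_kernel_def by metis
  qed
qed

context
  assumes J: "complex_structure J"
begin

lemma is_bergman_kernel_exists: "\<exists>K. is_bergman_kernel K"
proof -
  obtain k where k: "\<And>y. y \<in> D \<Longrightarrow> reproducing_at y (k y)"
    using reproducing_at_exists[OF J] by metis
  let ?K = "\<lambda>x y. if x \<in> D \<and> y \<in> D then k y x else 0"
  have "reproducing_at y (\<lambda>x. ?K x y)" if "y \<in> D" for y
  proof -
    have "L2_inner D f (k y) = L2_inner D f (\<lambda>x. ?K x y)" for f
      using that by (intro L2_inner_cong) auto
    then show ?thesis
      using k[OF that] A2_cong[of "k y" "\<lambda>x. ?K x y"] that by (simp add: reproducing_at_def)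
  qed
  then have "is_bergman_kernel ?K"
    by (simp add: is_bergman_kernel_def)
  then show ?thesis
    by blast
qed

lemma is_bergman_kernel_bergman_gen: "is_bergman_kernel (bergman_gen J D)"
  unfolding bergman_gen_eq_The using is_bergman_kernel_exists is_bergman_kernel_unique by (metis theI)

lemma reproducing_at_bergman_gen: "y \<in> D \<Longrightarrow> reproducing_at y (\<lambda>x. bergman_gen J D x y)"
  using is_bergman_kernel_bergman_gen by (simp add: is_bergman_kernel_def)

lemma bergman_gen_outside: "x \<notin> D \<or> y \<notin> D \<Longrightarrow> bergman_gen J D x y = 0"
  using is_bergman_kernel_bergman_gen unfolding is_bergman_kernel_def by blast

lemma bergman_gen_A2: "y \<in> D \<Longrightarrow> (\<lambda>x. bergman_gen J D x y) \<in> A2 J D"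
  using reproducing_at_bergman_gen unfolding reproducing_at_def by blast

lemma bergman_gen_reproducing: "y \<in> D \<Longrightarrow> f \<in> A2 J D \<Longrightarrow> f y = L2_inner D f (\<lambda>x. bergman_gen J D x y)"
  using reproducing_at_bergman_gen unfolding reproducing_at_def by blast

lemma bergman_gen_hermitian: "x \<in> D \<Longrightarrow> y \<in> D \<Longrightarrow> bergman_gen J D x y = cnj (bergman_gen J D y x)"
  by (intro reproducing_at_symmetric reproducing_at_bergman_gen)

lemma bergman_gen_eqI:
  assumes "x \<in> D" "y \<in> D" "g \<in> A2 J D" "\<And>f. f \<in> A2 J D \<Longrightarrow> f y = L2_inner D f g"
  shows "bergman_gen J D x y = g x"
proof -
  have "reproducing_at y g"
    using assms by (simp add: reproducing_at_def)
  then have "g x = cnj (bergman_gen J D y x)"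
    using reproducing_at_bergman_gen[OF \<open>x \<in> D\<close>] by (rule reproducing_at_symmetric)
  then show ?thesis
    using assms by (simp add: bergman_gen_hermitian[of x y])
qed

end

end

section \<open>Slices and changes of variables\<close>

lemma
  fixes F :: "'a::euclidean_space \<times> 'b::euclidean_space \<Rightarrow> ennreal"
  assumes F: "F \<in> borel_measurable borel"
  shows nn_integral_lborel_slices: "(\<integral>\<^sup>+w. \<integral>\<^sup>+x. F (x, w) \<partial>lborel \<partial>lborel) = (\<integral>\<^sup>+z. F z \<partial>lborel)"
    and borel_measurable_nn_integral_slice: "(\<lambda>w. \<integral>\<^sup>+x. F (x, w) \<partial>lborel) \<in> borel_measurable borel"
proof -
  have prod: "F \<in> borel_measurable (lborel \<Otimes>\<^sub>M lborel)"
    using F by (simp add: lborel_prod)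
  then show "(\<integral>\<^sup>+w. \<integral>\<^sup>+x. F (x, w) \<partial>lborel \<partial>lborel) = (\<integral>\<^sup>+z. F z \<partial>lborel)"
    using lborel_pair.nn_integral_snd by (simp add: lborel_prod)
  show "(\<lambda>w. \<integral>\<^sup>+x. F (x, w) \<partial>lborel) \<in> borel_measurable borel"
    using lborel.borel_measurable_nn_integral[OF measurable_pair_swap[OF prod]] by simp
qed

lemma
  fixes F :: "'a::euclidean_space \<times> 'b::euclidean_space \<Rightarrow> 'c::{banach, second_countable_topology}"
  assumes "set_integrable lborel D F"
  shows set_integral_lborel_slices:
      "(LINT w|lborel. (LINT x:{x. (x, w) \<in> D}|lborel. F (x, w))) = (LINT z:D|lborel. F z)"
    and integrable_set_integral_slice: "integrable lborel (\<lambda>w. (LINT x:{x. (x, w) \<in> D}|lborel. F (x, w)))"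
proof -
  have slice: "indicator {x. (x, w) \<in> D} x *\<^sub>R F (x, w) = indicator D (x, w) *\<^sub>R F (x, w)" for x w
    by (simp add: indicator_def)
  have prod: "integrable (lborel \<Otimes>\<^sub>M lborel) (\<lambda>(x, w). indicator D (x, w) *\<^sub>R F (x, w))"
    using assms by (simp add: set_integrable_def lborel_prod case_prod_beta')
  show "(LINT w|lborel. (LINT x:{x. (x, w) \<in> D}|lborel. F (x, w))) = (LINT z:D|lborel. F z)"
    using lborel_pair.integral_snd[OF prod]
    by (simp add: set_lebesgue_integral_def slice lborel_prod case_prod_beta')
  show "integrable lborel (\<lambda>w. (LINT x:{x. (x, w) \<in> D}|lborel. F (x, w)))"
    using lborel_pair.integrable_snd[OF prod] by (simp add: set_lebesgue_integral_def slice)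
qed

lemma open_slice:
  assumes "open D"
  shows "open {x. (x, w) \<in> D}"
proof -
  have "{x. (x, w) \<in> D} = (\<lambda>x. (x, w)) -` D"
    by auto
  then show ?thesis
    using assms by (simp add: open_vimage continuous_on_Pair continuous_on_id continuous_on_const)
qed

lemma A2_slice_AE:
  fixes J :: "'a::euclidean_space \<Rightarrow> 'a" and J' :: "'b::euclidean_space \<Rightarrow> 'b"
  assumes D: "open D" and "J' 0 = 0" and f: "f \<in> A2 (\<lambda>(x, w). (J x, J' w)) D"
  shows "AE w in lborel. (\<lambda>x. f (x, w)) \<in> A2 J {x. (x, w) \<in> D}"
proof -
  define F where "F z = ennreal ((cmod (f z))\<^sup>2) * indicator D z" for z
  have F: "F \<in> borel_measurable borel"
    unfolding F_def by (rule borel_measurable_cmod_square_on_open[OF D A2_continuous_on[OF D f]])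
  have "(\<integral>\<^sup>+w. \<integral>\<^sup>+x. F (x, w) \<partial>lborel \<partial>lborel) < \<infinity>"
    using f unfolding nn_integral_lborel_slices[OF F] by (simp add: F_def[abs_def] A2_iff_nn_integral[OF D])
  then have "AE w in lborel. (\<integral>\<^sup>+x. F (x, w) \<partial>lborel) \<noteq> \<infinity>"
    using borel_measurable_nn_integral_slice[OF F] by (intro nn_integral_PInf_AE) auto
  then show ?thesis
  proof (rule AE_mp, intro AE_I2 impI)
    fix w assume fin: "(\<integral>\<^sup>+x. F (x, w) \<partial>lborel) \<noteq> \<infinity>"
    have "cholo_map J J (\<lambda>x. x) {x. (x, w) \<in> D}"
      by (simp add: cholo_map_linear linear_ident)
    moreover have "cholo_map J J' (\<lambda>x. w) {x. (x, w) \<in> D}"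
      unfolding cholo_map_def using \<open>J' 0 = 0\<close> by (intro ballI exI[of _ "\<lambda>x. 0"]) auto
    ultimately have "cholo_map J (\<lambda>(x, w). (J x, J' w)) (\<lambda>x. (x, w)) {x. (x, w) \<in> D}"
      by (rule cholo_map_Pair)
    then have "cholo_on J (\<lambda>x. f (x, w)) {x. (x, w) \<in> D}"
      using A2_cholo_on[OF D f] by (rule cholo_on_compose) auto
    moreover have "F (x, w) = ennreal ((cmod (f (x, w)))\<^sup>2) * indicator {x. (x, w) \<in> D} x" for x
      by (simp add: F_def indicator_def)
    ultimately show "(\<lambda>x. f (x, w)) \<in> A2 J {x. (x, w) \<in> D}"
      using fin by (simp add: A2_iff_nn_integral[OF open_slice[OF D]] less_top)
  qed
qed

locale weighted_pullback =
  fixes J :: "'a::euclidean_space \<Rightarrow> 'a" and J' :: "'b::euclidean_space \<Rightarrow> 'b"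
    and D :: "'a set" and D' :: "'b set" and \<Phi> :: "'a \<Rightarrow> 'b" and u :: "'a \<Rightarrow> complex"
  assumes complex_structures: "complex_structure J" "complex_structure J'"
    and open_D: "open D" and open_D': "open D'"
    and mem_iff: "\<And>x. \<Phi> x \<in> D' \<longleftrightarrow> x \<in> D"
    and cholo_map: "cholo_map J J' \<Phi> D" and cholo_weight: "cholo_on J u D"
    and weight_nonzero: "\<And>x. x \<in> D \<Longrightarrow> u x \<noteq> 0"
    and borel_map[measurable]: "\<Phi> \<in> borel_measurable borel"
    and borel_weight[measurable]: "u \<in> borel_measurable borel"
    and jacobian: "distr (density lborel (\<lambda>x. ennreal ((cmod (u x))\<^sup>2))) borel \<Phi> = lborel"
begin

lemma indicator_pullback: "indicator D' (\<Phi> x) = indicator D x"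
  by (simp add: indicator_def mem_iff)

lemma nn_integral_pullback:
  assumes [measurable]: "F \<in> borel_measurable borel"
  shows "(\<integral>\<^sup>+x. F x \<partial>lborel) = (\<integral>\<^sup>+x. ennreal ((cmod (u x))\<^sup>2) * F (\<Phi> x) \<partial>lborel)"
proof -
  have "(\<integral>\<^sup>+x. F x \<partial>lborel) = (\<integral>\<^sup>+x. F (\<Phi> x) \<partial>density lborel (\<lambda>x. ennreal ((cmod (u x))\<^sup>2)))"
    by (subst jacobian[symmetric], subst nn_integral_distr) simp_all
  then show ?thesis
    by (simp add: nn_integral_density)
qed

lemma integral_pullback:
  fixes F :: "'b \<Rightarrow> 'c::{banach, second_countable_topology}"
  assumes [measurable]: "F \<in> borel_measurable borel"
  shows "(LINT x|lborel. F x) = (LINT x|lborel. (cmod (u x))\<^sup>2 *\<^sub>R F (\<Phi> x))"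
proof -
  have "(LINT x|lborel. F x) = (LINT x|density lborel (\<lambda>x. ennreal ((cmod (u x))\<^sup>2)). F (\<Phi> x))"
    by (subst jacobian[symmetric], subst integral_distr) simp_all
  then show ?thesis
    by (simp add: integral_density)
qed

lemma A2_pullback_iff:
  assumes f: "cholo_on J' f D'"
  shows "(\<lambda>x. u x * f (\<Phi> x)) \<in> A2 J D \<longleftrightarrow> f \<in> A2 J' D'"
proof -
  have "(\<integral>\<^sup>+x\<in>D'. ennreal ((cmod (f x))\<^sup>2) \<partial>lborel)
      = (\<integral>\<^sup>+x. ennreal ((cmod (u x))\<^sup>2) * (ennreal ((cmod (f (\<Phi> x)))\<^sup>2) * indicator D' (\<Phi> x)) \<partial>lborel)"
    using open_D' cholo_on_imp_continuous_on[OF f]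
    by (intro nn_integral_pullback borel_measurable_cmod_square_on_open)
  also have "\<dots> = (\<integral>\<^sup>+x\<in>D. ennreal ((cmod (u x * f (\<Phi> x)))\<^sup>2) \<partial>lborel)"
    by (simp add: indicator_pullback norm_mult power_mult_distrib ennreal_mult mult.assoc)
  finally have "(\<integral>\<^sup>+x\<in>D'. ennreal ((cmod (f x))\<^sup>2) \<partial>lborel)
      = (\<integral>\<^sup>+x\<in>D. ennreal ((cmod (u x * f (\<Phi> x)))\<^sup>2) \<partial>lborel)" .
  moreover have "cholo_on J (\<lambda>x. u x * f (\<Phi> x)) D"
    using mem_iff by (intro cholo_on_mult cholo_weight cholo_on_compose[OF cholo_map f]) simp
  ultimately show ?thesis
    using f by (simp add: A2_iff_nn_integral open_D open_D')
qed

lemma L2_inner_pullback: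
  assumes "f \<in> A2 J' D'" "g \<in> A2 J' D'"
  shows "L2_inner D (\<lambda>x. u x * f (\<Phi> x)) (\<lambda>x. u x * g (\<Phi> x)) = L2_inner D' f g"
proof -
  have "(\<lambda>x. indicator D' x *\<^sub>R (f x * cnj (g x))) \<in> borel_measurable borel"
    using open_D' assms A2_continuous_on[OF open_D']
    by (intro borel_measurable_continuous_on_indicator continuous_intros) auto
  then have "L2_inner D' f g
      = (LINT x|lborel. (cmod (u x))\<^sup>2 *\<^sub>R (indicator D' (\<Phi> x) *\<^sub>R (f (\<Phi> x) * cnj (g (\<Phi> x)))))"
    unfolding L2_inner_def set_lebesgue_integral_def by (rule integral_pullback)
  also have "\<dots> = L2_inner D (\<lambda>x. u x * f (\<Phi> x)) (\<lambda>x. u x * g (\<Phi> x))"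
    unfolding L2_inner_def set_lebesgue_integral_def indicator_pullback
    by (intro Bochner_Integration.integral_cong refl)
      (simp only: scaleR_conv_of_real complex_norm_square complex_cnj_mult mult_ac)
  finally show ?thesis by simp
qed

lemma A2_pullback_surj:
  assumes \<Psi>: "cholo_map J' J \<Psi> D'" "\<And>x. x \<in> D' \<Longrightarrow> \<Psi> x \<in> D" "\<And>x. x \<in> D \<Longrightarrow> \<Psi> (\<Phi> x) = x"
    and f: "f \<in> A2 J D"
  obtains g where "g \<in> A2 J' D'" "\<And>x. x \<in> D \<Longrightarrow> u x * g (\<Phi> x) = f x"
proof
  define g where "g x = f (\<Psi> x) / u (\<Psi> x)" for x
  show pull: "u x * g (\<Phi> x) = f x" if "x \<in> D" for x
    using \<Psi>(3)[OF that] weight_nonzero[OF that] by (simp add: g_def)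
  have "cholo_on J (\<lambda>x. inverse (u x)) D"
    using weight_nonzero
    by (intro cholo_on_compose_holomorphic[OF cholo_weight, of _ "- {0}"] holomorphic_intros) auto
  then have "cholo_on J (\<lambda>x. f x / u x) D"
    unfolding divide_inverse by (intro cholo_on_mult A2_cholo_on[OF open_D f])
  then have "cholo_on J' g D'"
    unfolding g_def[abs_def] using \<Psi>(2) by (rule cholo_on_compose[OF \<Psi>(1)])
  moreover have "(\<lambda>x. u x * g (\<Phi> x)) \<in> A2 J D"
    by (rule A2_cong[OF open_D _ f]) (simp add: pull)
  ultimately show "g \<in> A2 J' D'"
    by (simp only: A2_pullback_iff)
qed

theorem bergman_gen_pullback:
  assumes \<Psi>: "cholo_map J' J \<Psi> D'" "\<And>x. x \<in> D' \<Longrightarrow> \<Psi> x \<in> D" "\<And>x. x \<in> D \<Longrightarrow> \<Psi> (\<Phi> x) = x"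
  shows "bergman_gen J D x y = u x * bergman_gen J' D' (\<Phi> x) (\<Phi> y) * cnj (u y)"
proof (cases "x \<in> D \<and> y \<in> D")
  case True
  then have \<Phi>y: "\<Phi> y \<in> D'"
    by (simp add: mem_iff)
  let ?k = "\<lambda>z. bergman_gen J' D' z (\<Phi> y)"
  have k: "?k \<in> A2 J' D'"
    by (rule bergman_gen_A2[OF open_D' complex_structures(2) \<Phi>y])
  define h where "h x = cnj (u y) * (u x * ?k (\<Phi> x))" for x
  have "h \<in> A2 J D"
    unfolding h_def[abs_def] using k
    by (intro A2_cmult open_D) (simp only: A2_pullback_iff[OF A2_cholo_on[OF open_D' k]])
  moreover have "f y = L2_inner D f h" if "f \<in> A2 J D" for f
  proof -
    obtain g where g: "g \<in> A2 J' D'" and pull: "\<And>x. x \<in> D \<Longrightarrow> u x * g (\<Phi> x) = f x"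
      using A2_pullback_surj[OF \<Psi> \<open>f \<in> A2 J D\<close>] by blast
    have "f y = u y * L2_inner D' g ?k"
      using pull[of y] True bergman_gen_reproducing[OF open_D' complex_structures(2) \<Phi>y g] by simp
    also have "L2_inner D' g ?k = L2_inner D (\<lambda>x. u x * g (\<Phi> x)) (\<lambda>x. u x * ?k (\<Phi> x))"
      using L2_inner_pullback[OF g k] by simp
    also have "\<dots> = L2_inner D f (\<lambda>x. u x * ?k (\<Phi> x))"
      using pull by (intro L2_inner_cong) auto
    also have "u y * \<dots> = L2_inner D f h"
      unfolding h_def[abs_def] by (simp add: L2_inner_cmult_right)
    finally show ?thesis .
  qed
  ultimately have "bergman_gen J D x y = h x"
    using True by (intro bergman_gen_eqI open_D complex_structures) auto
  then show ?thesis
    by (simp add: h_def mult_ac)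
next
  case False
  then show ?thesis
    by (simp add: bergman_gen_outside[OF open_D complex_structures(1)]
        bergman_gen_outside[OF open_D' complex_structures(2)] mem_iff)
qed

end

section \<open>Exponential scalings of complex coordinates\<close>

lemma holomorphic_eq_if_eq_on_imaginary_axis:
  assumes "f holomorphic_on A" "g holomorphic_on A" "open A" "connected A"
    and axis: "{b. Re b = 0} \<subseteq> A" and eq: "\<And>b. Re b = 0 \<Longrightarrow> f b = g b" and "a \<in> A"
  shows "f a = g a"
proof -
  have "0 islimpt {b. Re b = 0}"
  proof (rule connected_imp_perfect)
    show "connected {b. Re b = 0}"
      by (intro convex_connected convexI) auto
    show "{b. Re b = 0} \<noteq> {c}" for c
    proof
      assume "{b. Re b = 0} = {c}"
      moreover have "0 \<in> {b. Re b = 0}" "\<i> \<in> {b. Re b = 0}"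
        by auto
      ultimately show False
        by auto
    qed
  qed simp
  moreover have "(\<lambda>b. f b - g b) holomorphic_on A" "0 \<in> A"
    using assms by (auto intro: holomorphic_on_diff)
  ultimately have "f a - g a = 0"
    using analytic_continuation[of "\<lambda>b. f b - g b" A "{b. Re b = 0}" 0 a] assms by simp
  then show ?thesis
    by simp
qed

abbreviation J_vec :: "complex^'n \<Rightarrow> complex^'n" where
  "J_vec \<equiv> \<lambda>v. \<i> *s v"

abbreviation J_prod :: "(complex^'n) \<times> complex \<Rightarrow> (complex^'n) \<times> complex" where
  "J_prod \<equiv> \<lambda>(v, t). (\<i> *s v, \<i> * t)"

lemma norm_vector_smult: "norm (c *s (x :: complex^'n)) = cmod c * norm x"
proof -
  have "(norm (c *s x))\<^sup>2 = (cmod c * norm x)\<^sup>2"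
    unfolding norm_vec_def L2_set_def
    by (simp add: norm_mult power_mult_distrib sum_nonneg sum_distrib_left)
  then show ?thesis
    by (simp add: power2_eq_iff_nonneg)
qed

lemma complex_structure_vec: "complex_structure J_vec"
  unfolding complex_structure_def
  by (auto simp: norm_vector_smult vec_eq_iff algebra_simps intro!: linearI)

lemma complex_structure_prod: "complex_structure J_prod"
  unfolding complex_structure_def
  by (auto simp: norm_vector_smult vec_eq_iff algebra_simps norm_Pair norm_mult intro!: linearI)

lemma cscale_vec: "cscale J_vec \<mu> v = \<mu> *s v"
  by (auto simp: cscale_def vec_eq_iff complex_eq_iff)

lemma cscale_prod: "cscale J_prod \<mu> (v, t) = (\<mu> *s v, \<mu> * t)"
  by (auto simp: cscale_def vec_eq_iff complex_eq_iff)

definition expscale :: "'N set \<Rightarrow> ('N \<Rightarrow> real) \<Rightarrow> complex \<Rightarrow> complex^'N::finite \<Rightarrow> complex^'N" where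
  "expscale S \<gamma> a = dscale (\<lambda>j. if j \<in> S then exp (of_real (\<gamma> j) * a) else 1)"

lemma expscale_nth: "expscale S \<gamma> a x $ j = (if j \<in> S then exp (of_real (\<gamma> j) * a) * x $ j else x $ j)"
  by (simp add: expscale_def)

lemma expscale_add: "expscale S \<gamma> a (expscale S \<gamma> b x) = expscale S \<gamma> (a + b) x"
  by (simp add: vec_eq_iff expscale_nth exp_add ring_distribs)

lemma expscale_0 [simp]: "expscale S \<gamma> 0 x = x"
  by (simp add: vec_eq_iff expscale_nth)

lemma continuous_on_expscale [continuous_intros]:
  assumes "continuous_on A a" "continuous_on A f"
  shows "continuous_on A (\<lambda>p. expscale S \<gamma> (a p) (f p))"
  unfolding expscale_def
proof (intro continuous_on_dscale)
  show "continuous_on A (\<lambda>p. if j \<in> S then exp (of_real (\<gamma> j) * a p) else 1)" for j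
    using assms by (cases "j \<in> S") (auto intro!: continuous_intros)
qed fact

lemma cholo_map_expscale:
  fixes f :: "'a::euclidean_space \<Rightarrow> complex^'n"
  assumes a: "cholo_on J a D" and f: "cholo_map J J_vec f D"
  shows "cholo_map J J_vec (\<lambda>p. expscale S \<gamma> (a p) (f p)) D"
proof (rule cholo_map_vecI)
  fix j :: 'n
  have "cholo_on J_vec (\<lambda>v. v $ j) UNIV"
    by (intro cholo_on_linear linearI) auto
  then have coord: "cholo_on J (\<lambda>p. f p $ j) D"
    using cholo_on_compose[OF f] by blast
  have "cholo_on J (\<lambda>p. of_real (\<gamma> j) * a p) D"
    by (intro cholo_on_mult cholo_on_const a)
  then have "cholo_on J (\<lambda>p. exp (of_real (\<gamma> j) * a p)) D"
    using holomorphic_on_exp[of UNIV] by (rule cholo_on_compose_holomorphic) auto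
  then have "cholo_on J (\<lambda>p. exp (of_real (\<gamma> j) * a p) * f p $ j) D"
    using coord by (rule cholo_on_mult)
  then show "cholo_on J (\<lambda>p. expscale S \<gamma> (a p) (f p) $ j) D"
    using coord by (cases "j \<in> S") (simp_all add: expscale_nth)
qed

lemma cholo_map_expscale_vec: "cholo_map J_vec J_vec (expscale S \<gamma> a) D"
  by (intro cholo_map_expscale cholo_on_const cholo_map_linear linear_ident) simp

lemma lborel_distr_expscale:
  "distr (density lborel (\<lambda>_. ennreal ((cmod (exp (of_real (sum \<gamma> S) * a)))\<^sup>2))) borel (expscale S \<gamma> a) = lborel"
proof -
  let ?c = "\<lambda>j. if j \<in> S then exp (of_real (\<gamma> j) * a) else 1"
  have "(\<Prod>j\<in>UNIV. (cmod (?c j))\<^sup>2) = (\<Prod>j\<in>S. (cmod (exp (of_real (\<gamma> j) * a)))\<^sup>2)"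
    by (rule prod.mono_neutral_cong_right) auto
  also have "\<dots> = (cmod (\<Prod>j\<in>S. exp (of_real (\<gamma> j) * a)))\<^sup>2"
    by (simp only: prod_power_distrib prod_norm[symmetric])
  also have "(\<Prod>j\<in>S. exp (of_real (\<gamma> j) * a)) = exp (of_real (sum \<gamma> S) * a)"
    by (simp add: exp_sum[symmetric] sum_distrib_right)
  finally show ?thesis
    using lborel_distr_dscale[of ?c] by (simp add: expscale_def)
qed

lemma nn_integral_expscale:
  assumes [measurable]: "F \<in> borel_measurable borel"
  shows "(\<integral>\<^sup>+x. F (expscale S \<gamma> a x) * ennreal ((cmod (exp (of_real (sum \<gamma> S) * a)))\<^sup>2) \<partial>lborel)
    = (\<integral>\<^sup>+x. F x \<partial>lborel)"
proof -
  have [measurable]: "expscale S \<gamma> a \<in> borel_measurable borel"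
    by (intro borel_measurable_continuous_onI continuous_intros)
  show ?thesis
    by (subst (2) lborel_distr_expscale[of \<gamma> S a, symmetric])
      (simp add: nn_integral_distr nn_integral_density mult.commute)
qed

definition star_hull :: "'N set \<Rightarrow> complex^'N \<Rightarrow> (complex^'N::finite) set" where
  "star_hull S x = {y. \<forall>j. if j \<in> S then cmod (y $ j) \<le> cmod (x $ j) else y $ j = x $ j}"

lemma star_hull_norm_nth_le: "y \<in> star_hull S x \<Longrightarrow> cmod (y $ j) \<le> cmod (x $ j)"
  unfolding star_hull_def by (cases "j \<in> S") (auto dest: spec[of _ j])

lemma compact_star_hull: "compact (star_hull S x)"
proof -
  have "bounded (star_hull S x)"
    unfolding bounded_iff
    by (intro exI[of _ "norm x"] ballI norm_le_componentwise_cart star_hull_norm_nth_le)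
  moreover have "closed (star_hull S x)"
    unfolding star_hull_def
  proof (rule closed_Collect_all)
    show "closed {y. if j \<in> S then cmod (y $ j) \<le> cmod (x $ j) else y $ j = x $ j}" for j
      by (cases "j \<in> S") (auto intro!: closed_Collect_le closed_Collect_eq continuous_intros)
  qed
  ultimately show ?thesis
    by (simp add: compact_eq_bounded_closed)
qed

lemma star_hartogs_star_hull_subset:
  assumes star: "star_hartogs S \<Omega>" and "x \<in> \<Omega>"
  shows "star_hull S x \<subseteq> \<Omega>"
proof
  fix y assume y: "y \<in> star_hull S x"
  let ?c = "\<lambda>j. y $ j / x $ j"
  have "cmod (?c j) \<le> 1" for j
    using star_hull_norm_nth_le[OF y, of j] by (simp add: norm_divide divide_le_eq_1)
  then have "(\<chi> j. if j \<in> S then ?c j * x $ j else x $ j) \<in> \<Omega>"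
    using star \<open>x \<in> \<Omega>\<close> unfolding star_hartogs_def by simp
  moreover have "(if j \<in> S then ?c j * x $ j else x $ j) = y $ j" for j
    using y star_hull_norm_nth_le[OF y, of j]
    by (cases "x $ j = 0") (auto simp: star_hull_def dest: spec[of _ j])
  ultimately show "y \<in> \<Omega>"
    by simp
qed

lemma bergman_vec_expscale:
  assumes "open \<Omega>"
  shows "bergman_vec (expscale S \<gamma> a -` \<Omega>) x y =
    of_real (exp (2 * sum \<gamma> S * Re a)) * bergman_vec \<Omega> (expscale S \<gamma> a x) (expscale S \<gamma> a y)"
proof -
  let ?u = "exp (of_real (sum \<gamma> S) * a)"
  interpret weighted_pullback J_vec J_vec "expscale S \<gamma> a -` \<Omega>" \<Omega> "expscale S \<gamma> a" "\<lambda>_. ?u"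
  proof
    show "open (expscale S \<gamma> a -` \<Omega>)"
      using assms by (intro open_vimage continuous_intros)
    show "expscale S \<gamma> a \<in> borel_measurable borel"
      by (intro borel_measurable_continuous_onI continuous_intros)
  qed (rule complex_structure_vec assms cholo_map_expscale_vec cholo_on_const lborel_distr_expscale | simp)+
  have "bergman_vec (expscale S \<gamma> a -` \<Omega>) x y
      = ?u * bergman_vec \<Omega> (expscale S \<gamma> a x) (expscale S \<gamma> a y) * cnj ?u"
    unfolding bergman_vec_def
    by (rule bergman_gen_pullback[of "expscale S \<gamma> (- a)"]) (simp_all add: cholo_map_expscale_vec expscale_add)
  moreover have "?u * cnj ?u = of_real (exp (2 * sum \<gamma> S * Re a))"
    unfolding complex_norm_square[symmetric] norm_exp_eq_Re by (simp add: mult.assoc exp_double)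
  ultimately show ?thesis
    by (simp add: mult_ac)
qed

locale hartogs =
  fixes S :: "'N::finite set" and \<gamma> :: "'N \<Rightarrow> real" and \<Omega> :: "(complex^'N) set"
  assumes open_\<Omega>: "open \<Omega>" and star: "star_hartogs S \<Omega>" and \<gamma>_pos: "\<And>j. j \<in> S \<Longrightarrow> \<gamma> j > 0"
    and S_nonempty: "S \<noteq> {}"
begin

abbreviation K\<^sub>\<Omega> :: "complex^'N \<Rightarrow> complex^'N \<Rightarrow> complex" where
  "K\<^sub>\<Omega> \<equiv> bergman_vec \<Omega>"

lemma bergman_vec_A2: "x \<in> \<Omega> \<Longrightarrow> (\<lambda>y. K\<^sub>\<Omega> y x) \<in> A2 J_vec \<Omega>"
  unfolding bergman_vec_def by (rule bergman_gen_A2[OF open_\<Omega> complex_structure_vec])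

lemma bergman_vec_cholo_on: "x \<in> \<Omega> \<Longrightarrow> cholo_on J_vec (\<lambda>y. K\<^sub>\<Omega> y x) \<Omega>"
  using A2_cholo_on[OF open_\<Omega>] bergman_vec_A2 by blast

lemma bergman_vec_hermitian: "x \<in> \<Omega> \<Longrightarrow> y \<in> \<Omega> \<Longrightarrow> K\<^sub>\<Omega> x y = cnj (K\<^sub>\<Omega> y x)"
  unfolding bergman_vec_def by (rule bergman_gen_hermitian[OF open_\<Omega> complex_structure_vec])

lemma expscale_mem_star_hull: "Re a \<le> 0 \<Longrightarrow> expscale S \<gamma> a x \<in> star_hull S x"
  by (auto simp: star_hull_def expscale_nth norm_mult mult_nonneg_nonpos less_imp_le[OF \<gamma>_pos]
      intro!: mult_left_le_one_le)

lemma expscale_mem: "x \<in> \<Omega> \<Longrightarrow> Re a \<le> 0 \<Longrightarrow> expscale S \<gamma> a x \<in> \<Omega>"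
  using star_hartogs_star_hull_subset[OF star] expscale_mem_star_hull by blast

lemma expscale_mem_mono:
  assumes "expscale S \<gamma> b x \<in> \<Omega>" "Re a \<le> Re b"
  shows "expscale S \<gamma> a x \<in> \<Omega>"
  using expscale_mem[OF assms(1), of "a - b"] assms(2) by (simp add: expscale_add)

lemma open_expscale_mem: "open {a. expscale S \<gamma> a x \<in> \<Omega>}"
  using open_vimage[OF open_\<Omega>, of "\<lambda>a. expscale S \<gamma> a x"] by (simp add: vimage_def continuous_intros)

lemma convex_expscale_mem: "convex {a. expscale S \<gamma> a x \<in> \<Omega>}"
proof (rule convexI)
  fix a b :: complex and s t :: real
  assume ab: "a \<in> {a. expscale S \<gamma> a x \<in> \<Omega>}" "b \<in> {a. expscale S \<gamma> a x \<in> \<Omega>}" and "0 \<le> s" "0 \<le> t" "s + t = 1"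
  then have "Re (s *\<^sub>R a + t *\<^sub>R b) \<le> max (Re a) (Re b)"
    using convex_bound_le[of "Re a" "max (Re a) (Re b)" "Re b" s t] by simp
  then show "s *\<^sub>R a + t *\<^sub>R b \<in> {a. expscale S \<gamma> a x \<in> \<Omega>}"
    using ab expscale_mem_mono by (auto simp: max_def split: if_splits)
qed

lemma holomorphic_on_expscale_orbit:
  assumes "cholo_on J_vec f \<Omega>"
  shows "(\<lambda>a. f (expscale S \<gamma> a x)) holomorphic_on {a. expscale S \<gamma> a x \<in> \<Omega>}"
proof -
  have "cholo_on ((*) \<i>) (\<lambda>a. a) {a. expscale S \<gamma> a x \<in> \<Omega>}"
    by (intro cholo_on_linear linear_ident) simp
  moreover have "cholo_map ((*) \<i>) J_vec (\<lambda>a. x) {a. expscale S \<gamma> a x \<in> \<Omega>}"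
    by (intro cholo_map_vecI cholo_on_const)
  ultimately have "cholo_map ((*) \<i>) J_vec (\<lambda>a. expscale S \<gamma> a x) {a. expscale S \<gamma> a x \<in> \<Omega>}"
    by (rule cholo_map_expscale)
  then have "cholo_on ((*) \<i>) (\<lambda>a. f (expscale S \<gamma> a x)) {a. expscale S \<gamma> a x \<in> \<Omega>}"
    using assms by (rule cholo_on_compose) simp
  then show ?thesis
    by (simp add: cholo_on_complex_iff open_expscale_mem)
qed

lemma bounded_on_expscale_orbit:
  fixes f :: "complex^'N \<Rightarrow> complex"
  assumes f: "continuous_on \<Omega> f" and x: "x \<in> \<Omega>"
  obtains B where "\<And>a. Re a \<le> 0 \<Longrightarrow> cmod (f (expscale S \<gamma> a x)) \<le> B"
proof -
  have "bounded (f ` star_hull S x)"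
    using star_hartogs_star_hull_subset[OF star x] compact_star_hull
    by (intro compact_imp_bounded compact_continuous_image continuous_on_subset[OF f])
  then obtain B where "\<And>y. y \<in> star_hull S x \<Longrightarrow> cmod (f y) \<le> B"
    unfolding bounded_iff by blast
  then show thesis
    using that expscale_mem_star_hull by blast
qed

lemma bergman_vec_rotation_adjoint:
  assumes x: "x \<in> \<Omega>" and y: "y \<in> \<Omega>" and "Re a = 0"
  shows "K\<^sub>\<Omega> (expscale S \<gamma> a y) x = K\<^sub>\<Omega> y (expscale S \<gamma> (cnj a) x)"
proof -
  have "expscale S \<gamma> a v \<in> \<Omega> \<longleftrightarrow> v \<in> \<Omega>" for v
    using expscale_mem_mono[of a v 0] expscale_mem[of v a] \<open>Re a = 0\<close> by auto
  then have "expscale S \<gamma> a -` \<Omega> = \<Omega>"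
    by auto
  moreover have "a + cnj a = 0"
    using \<open>Re a = 0\<close> by (simp add: complex_eq_iff)
  ultimately show ?thesis
    using bergman_vec_expscale[OF open_\<Omega>, of S \<gamma> a y "expscale S \<gamma> (cnj a) x"] \<open>Re a = 0\<close>
    by (simp add: expscale_add)
qed

lemma bergman_vec_expscale_adjoint:
  assumes x: "x \<in> \<Omega>" "expscale S \<gamma> a x \<in> \<Omega>" and y: "y \<in> \<Omega>" "expscale S \<gamma> a y \<in> \<Omega>"
  shows "K\<^sub>\<Omega> (expscale S \<gamma> a y) x = K\<^sub>\<Omega> y (expscale S \<gamma> (cnj a) x)"
proof -
  define A where "A = {b. expscale S \<gamma> b y \<in> \<Omega>} \<inter> {b. expscale S \<gamma> b x \<in> \<Omega>}"
  have cnj_mem: "expscale S \<gamma> (cnj b) x \<in> \<Omega>" if "expscale S \<gamma> b x \<in> \<Omega>" for b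
    using that by (rule expscale_mem_mono) simp
  have K_swap: "K\<^sub>\<Omega> y (expscale S \<gamma> (cnj b) x) = cnj (K\<^sub>\<Omega> (expscale S \<gamma> (cnj b) x) y)" if "b \<in> A" for b
    using that cnj_mem by (intro bergman_vec_hermitian y) (simp add: A_def)
  have "K\<^sub>\<Omega> (expscale S \<gamma> a y) x = (cnj \<circ> (\<lambda>b. K\<^sub>\<Omega> (expscale S \<gamma> b x) y) \<circ> cnj) a"
  proof (rule holomorphic_eq_if_eq_on_imaginary_axis[where A = A and f = "\<lambda>b. K\<^sub>\<Omega> (expscale S \<gamma> b y) x"])
    show "open A"
      by (simp add: A_def open_Int open_expscale_mem)
    show "connected A"
      unfolding A_def by (intro convex_connected convex_Int convex_expscale_mem)
    show imaginary_axis: "{b. Re b = 0} \<subseteq> A"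
      using x y by (auto simp: A_def expscale_mem)
    show "a \<in> A"
      using x y by (simp add: A_def)
    show "(\<lambda>b. K\<^sub>\<Omega> (expscale S \<gamma> b y) x) holomorphic_on A"
      using holomorphic_on_expscale_orbit[OF bergman_vec_cholo_on[OF x(1)]]
      by (rule holomorphic_on_subset) (simp add: A_def)
    have "(\<lambda>b. K\<^sub>\<Omega> (expscale S \<gamma> b x) y) holomorphic_on cnj ` A"
      by (rule holomorphic_on_subset[OF holomorphic_on_expscale_orbit[OF bergman_vec_cholo_on[OF y(1)]]])
        (auto simp: A_def cnj_mem)
    then show "cnj \<circ> (\<lambda>b. K\<^sub>\<Omega> (expscale S \<gamma> b x) y) \<circ> cnj holomorphic_on A"
      using \<open>open A\<close> by (rule holomorphic_on_compose_cnj_cnj)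
    show "K\<^sub>\<Omega> (expscale S \<gamma> b y) x = (cnj \<circ> (\<lambda>b. K\<^sub>\<Omega> (expscale S \<gamma> b x) y) \<circ> cnj) b" if "Re b = 0" for b
      using bergman_vec_rotation_adjoint[OF x(1) y(1) that] K_swap[of b] imaginary_axis that by auto
  qed
  then show ?thesis
    using K_swap[of a] x y by (simp add: A_def)
qed

end

section \<open>Automorphisms of the Hartogs domain\<close>

lemma nn_integral_complex_affine:
  fixes F :: "complex \<Rightarrow> ennreal"
  assumes \<omega>: "cmod \<omega> = 1" and [measurable]: "F \<in> borel_measurable borel"
  shows "(\<integral>\<^sup>+w. F (\<omega> * w + b) \<partial>lborel) = (\<integral>\<^sup>+w. F w \<partial>lborel)"
proof -
  have "linear ((*) \<omega>)"
    by (rule linearI) (auto simp: algebra_simps)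
  then have rotation: "distr lborel borel ((*) \<omega>) = lborel"
    using \<omega> by (intro lborel_distr_linear_isometry) (simp_all add: norm_mult)
  have "(\<integral>\<^sup>+w. F w \<partial>lborel) = (\<integral>\<^sup>+w. F (b + w) \<partial>distr lborel borel ((*) \<omega>))"
    by (simp add: nn_integral_lborel_plus rotation)
  also have "\<dots> = (\<integral>\<^sup>+w. F (\<omega> * w + b) \<partial>lborel)"
    by (subst nn_integral_distr) (auto simp: add.commute)
  finally show ?thesis by simp
qed

definition hartogs_affine :: "'N set \<Rightarrow> ('N \<Rightarrow> real) \<Rightarrow> complex \<Rightarrow> complex \<Rightarrow> complex \<Rightarrow> complex \<Rightarrow>
    (complex^'N::finite) \<times> complex \<Rightarrow> (complex^'N) \<times> complex" where
  "hartogs_affine S \<gamma> p q \<omega> b = (\<lambda>z. (expscale S \<gamma> (p * snd z + q) (fst z), \<omega> * snd z + b))"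

lemma borel_measurable_hartogs_affine: "hartogs_affine S \<gamma> p q \<omega> b \<in> borel_measurable borel"
  unfolding hartogs_affine_def by (intro borel_measurable_continuous_onI continuous_intros)

lemma cholo_on_affine_snd: "cholo_on J_prod (\<lambda>z. p * snd z + q) D"
  by (intro cholo_on_add cholo_on_mult cholo_on_const cholo_on_linear linear_snd) auto

lemma cholo_map_hartogs_affine: "cholo_map J_prod J_prod (hartogs_affine S \<gamma> p q \<omega> b) D"
proof -
  have "cholo_map J_prod J_vec fst D"
    by (intro cholo_map_linear linear_fst) auto
  moreover have "cholo_map J_prod ((*) \<i>) (\<lambda>z. \<omega> * snd z + b) D"
    using cholo_on_affine_snd by (simp add: cholo_on_eq_cholo_map)
  ultimately show ?thesis
    unfolding hartogs_affine_def by (intro cholo_map_Pair cholo_map_expscale cholo_on_affine_snd)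
qed

lemma hartogs_affine_comp:
  "hartogs_affine S \<gamma> p' q' \<omega>' b' (hartogs_affine S \<gamma> p q \<omega> b z) =
    hartogs_affine S \<gamma> (p + p' * \<omega>) (q + p' * b + q') (\<omega>' * \<omega>) (\<omega>' * b + b') z"
  by (simp add: hartogs_affine_def expscale_add algebra_simps)

lemma hartogs_affine_id: "hartogs_affine S \<gamma> 0 0 1 0 z = z"
  by (simp add: hartogs_affine_def)

lemma lborel_distr_hartogs_affine:
  assumes \<omega>: "cmod \<omega> = 1"
  shows "distr (density lborel (\<lambda>z. ennreal ((cmod (exp (of_real (sum \<gamma> S) * (p * snd z + q))))\<^sup>2))) borel
    (hartogs_affine S \<gamma> p q \<omega> b) = lborel"
proof (rule distr_density_eq_lborelI)
  let ?u = "\<lambda>w. ennreal ((cmod (exp (of_real (sum \<gamma> S) * (p * w + q))))\<^sup>2)"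
  show u[measurable]: "(\<lambda>z::(complex^'a) \<times> complex. ?u (snd z)) \<in> borel_measurable borel"
    by (intro borel_measurable_continuous_onI measurable_compose[OF _ measurable_ennreal] continuous_intros)
  show [measurable]: "hartogs_affine S \<gamma> p q \<omega> b \<in> borel_measurable borel"
    by (rule borel_measurable_hartogs_affine)
  fix A :: "((complex^'a) \<times> complex) set" assume A[measurable]: "A \<in> sets borel"
  have slice: "(\<lambda>x. indicator A (x, w)) \<in> borel_measurable borel" for w
    by (intro measurable_compose[OF _ borel_measurable_indicator[OF A]] borel_measurable_continuous_onI
        continuous_intros)
  have "(\<lambda>z. indicator A (hartogs_affine S \<gamma> p q \<omega> b z) * ?u (snd z)) \<in> borel_measurable borel"
    using u by measurable
  then have "(\<integral>\<^sup>+z. indicator A (hartogs_affine S \<gamma> p q \<omega> b z) * ?u (snd z) \<partial>lborel)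
      = (\<integral>\<^sup>+w. \<integral>\<^sup>+x. indicator A (hartogs_affine S \<gamma> p q \<omega> b (x, w)) * ?u w \<partial>lborel \<partial>lborel)"
    by (subst nn_integral_lborel_slices[symmetric]) (simp_all only: snd_conv)
  also have "\<dots> = (\<integral>\<^sup>+w. (\<integral>\<^sup>+x. indicator A (x, \<omega> * w + b) \<partial>lborel) \<partial>lborel)"
    unfolding hartogs_affine_def fst_conv snd_conv by (simp only: nn_integral_expscale[OF slice])
  also have "\<dots> = (\<integral>\<^sup>+w. \<integral>\<^sup>+x. indicator A (x, w) \<partial>lborel \<partial>lborel)"
    by (rule nn_integral_complex_affine[OF \<omega> borel_measurable_nn_integral_slice]) simp
  also have "\<dots> = emeasure lborel A"
    by (subst nn_integral_lborel_slices) simp_all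
  finally show "(\<integral>\<^sup>+z. indicator A (hartogs_affine S \<gamma> p q \<omega> b z) * ?u (snd z) \<partial>lborel) = emeasure lborel A" .
qed

context hartogs
begin

abbreviation V :: "((complex^'N) \<times> complex) set" where
  "V \<equiv> V_gamma S \<gamma> \<Omega>"

abbreviation K\<^sub>V :: "(complex^'N) \<times> complex \<Rightarrow> (complex^'N) \<times> complex \<Rightarrow> complex" where
  "K\<^sub>V \<equiv> bergman_prod V"

abbreviation \<Gamma> :: real where
  "\<Gamma> \<equiv> sum \<gamma> S"

lemma mem_V: "(x, w) \<in> V \<longleftrightarrow> expscale S \<gamma> (of_real ((cmod w)\<^sup>2 / 2)) x \<in> \<Omega>"
proof -
  have "g_gamma S \<gamma> x w = expscale S \<gamma> (of_real ((cmod w)\<^sup>2 / 2)) x"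
    by (simp add: g_gamma_def vec_eq_iff expscale_nth)
  then show ?thesis
    by (simp add: V_gamma_def)
qed

lemma open_V: "open V"
proof -
  have "V = (\<lambda>z. expscale S \<gamma> (of_real ((cmod (snd z))\<^sup>2 / 2)) (fst z)) -` \<Omega>"
    using mem_V by auto
  moreover have "open \<dots>"
    by (intro open_vimage open_\<Omega> continuous_intros) auto
  ultimately show ?thesis by simp
qed

lemma mem_V_0: "(x, 0) \<in> V \<longleftrightarrow> x \<in> \<Omega>"
  by (simp add: mem_V)

lemma mem_V_mono:
  assumes "(x, w) \<in> V" "cmod v \<le> cmod w"
  shows "(x, v) \<in> V"
proof -
  have "(cmod v)\<^sup>2 \<le> (cmod w)\<^sup>2"
    using assms by (intro power_mono) auto
  then show ?thesis
    using assms expscale_mem_mono[of "of_real ((cmod w)\<^sup>2 / 2)" x "of_real ((cmod v)\<^sup>2 / 2)"] by (simp add: mem_V)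
qed

lemma mem_V_imp_mem_base: "(x, w) \<in> V \<Longrightarrow> x \<in> \<Omega>"
  using mem_V_mono[of x w 0] by (simp add: mem_V_0)

lemma bergman_prod_A2: "\<zeta> \<in> V \<Longrightarrow> (\<lambda>z. K\<^sub>V z \<zeta>) \<in> A2 J_prod V"
  unfolding bergman_prod_def by (rule bergman_gen_A2[OF open_V complex_structure_prod])

lemma hartogs_affine_mem_V:
  assumes "\<And>w. (cmod (\<omega> * w + b))\<^sup>2 / 2 + Re (p * w + q) = (cmod w)\<^sup>2 / 2"
  shows "hartogs_affine S \<gamma> p q \<omega> b z \<in> V \<longleftrightarrow> z \<in> V"
proof (cases z)
  case (Pair x w)
  have "Re (of_real ((cmod (\<omega> * w + b))\<^sup>2 / 2) + (p * w + q)) = Re (of_real ((cmod w)\<^sup>2 / 2))"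
    using assms[of w] by simp
  then show ?thesis
    unfolding Pair hartogs_affine_def fst_conv snd_conv mem_V expscale_add
    using expscale_mem_mono[of _ x] by (metis order_refl)
qed

lemma bergman_prod_hartogs_affine:
  assumes \<omega>: "cmod \<omega> = 1"
    and pq: "\<And>w. (cmod (\<omega> * w + b))\<^sup>2 / 2 + Re (p * w + q) = (cmod w)\<^sup>2 / 2"
  shows "K\<^sub>V z z' = exp (of_real \<Gamma> * (p * snd z + q)) *
    K\<^sub>V (hartogs_affine S \<gamma> p q \<omega> b z) (hartogs_affine S \<gamma> p q \<omega> b z') *
    cnj (exp (of_real \<Gamma> * (p * snd z' + q)))"
proof -
  let ?\<Phi> = "hartogs_affine S \<gamma> p q \<omega> b" and ?u = "\<lambda>z. exp (of_real \<Gamma> * (p * snd z + q))"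
  let ?\<Psi> = "hartogs_affine S \<gamma> (- p * cnj \<omega>) (p * cnj \<omega> * b - q) (cnj \<omega>) (- cnj \<omega> * b)"
  interpret weighted_pullback J_prod J_prod V V ?\<Phi> ?u
  proof
    show "?u \<in> borel_measurable borel"
      by (intro borel_measurable_continuous_onI continuous_intros)
    show "cholo_on J_prod ?u V"
      using cholo_on_mult[OF cholo_on_const cholo_on_affine_snd] holomorphic_on_exp[of UNIV]
      by (rule cholo_on_compose_holomorphic) auto
  qed (rule complex_structure_prod open_V hartogs_affine_mem_V[OF pq] cholo_map_hartogs_affine
        borel_measurable_hartogs_affine lborel_distr_hartogs_affine[OF \<omega>] exp_not_eq_zero)+
  have unit: "\<omega> * cnj \<omega> = 1" "cnj \<omega> * \<omega> = 1"
    using \<omega> complex_norm_square[of \<omega>] by (simp_all add: mult.commute)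
  then have cancel: "\<omega> * (cnj \<omega> * b) = b"
    by (metis mult.assoc mult_1)
  have \<Phi>_\<Psi>: "?\<Phi> (?\<Psi> z) = z" and "?\<Psi> (?\<Phi> z) = z" for z
    by (simp_all add: hartogs_affine_comp hartogs_affine_id mult.assoc unit cancel)
  moreover have "?\<Psi> z \<in> V" if "z \<in> V" for z
    using that hartogs_affine_mem_V[OF pq, of "?\<Psi> z"] by (simp only: \<Phi>_\<Psi>)
  ultimately show ?thesis
    unfolding bergman_prod_def by (intro bergman_gen_pullback[of ?\<Psi>] cholo_map_hartogs_affine)
qed

text \<open>The kernel with pole over \<open>0\<close> is invariant under rotations of \<open>w\<close>, so the mean value property applies.\<close>
lemma bergman_prod_base_pole:
  assumes x: "(x, w) \<in> V" and \<zeta>: "\<zeta> \<in> \<Omega>"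
  shows "K\<^sub>V (x, w) (\<zeta>, 0) = K\<^sub>V (x, 0) (\<zeta>, 0)"
proof -
  let ?u = "\<lambda>\<mu>. K\<^sub>V (x, \<mu> * w) (\<zeta>, 0)"
  have rotation: "?u (cis t) = K\<^sub>V (x, w) (\<zeta>, 0)" for t
    using bergman_prod_hartogs_affine[of "cis t" 0 0 0 "(x, w)" "(\<zeta>, 0)"]
    by (simp add: hartogs_affine_def norm_mult)
  let ?A = "{\<mu>. (x, \<mu> * w) \<in> V}"
  have "?A = (\<lambda>\<mu>. (x, \<mu> * w)) -` V"
    by auto
  then have A: "open ?A"
    by (simp add: open_vimage open_V continuous_intros)
  have "cholo_on J_prod (\<lambda>z. K\<^sub>V z (\<zeta>, 0)) V"
    using \<zeta> by (intro A2_cholo_on open_V bergman_prod_A2) (simp add: mem_V_0)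
  then have "(\<lambda>\<mu>. K\<^sub>V ((x, 0) + cscale J_prod \<mu> (0, w)) (\<zeta>, 0)) holomorphic_on ?A"
    using A by (intro holomorphic_on_cscale_line[where D = V]) (auto simp: cscale_prod)
  then have "?u holomorphic_on ?A"
    by (simp add: cscale_prod)
  moreover have "cball 0 1 \<subseteq> ?A"
    using mem_V_mono[OF x] by (auto simp: norm_mult mult_left_le_one_le)
  ultimately have "integral {0..2 * pi} (\<lambda>t. ?u (cis t)) = of_real (2 * pi) * ?u 0"
    by (intro integral_unique mean_value_circle)
  then show ?thesis
    by (simp add: rotation scaleR_conv_of_real)
qed

lemma bergman_prod_shift_to_base:
  assumes z: "(z, w) \<in> V" and \<zeta>: "(\<zeta>, \<eta>) \<in> V"
  defines "X \<equiv> expscale S \<gamma> (w * cnj \<eta> - of_real ((cmod \<eta>)\<^sup>2 / 2)) z"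
    and "\<zeta>' \<equiv> expscale S \<gamma> (of_real ((cmod \<eta>)\<^sup>2 / 2)) \<zeta>"
  shows "X \<in> \<Omega>" and "\<zeta>' \<in> \<Omega>"
    and "K\<^sub>V (z, w) (\<zeta>, \<eta>) = exp (of_real \<Gamma> * (w * cnj \<eta>)) * K\<^sub>V (X, 0) (\<zeta>', 0)"
proof -
  let ?q = "- of_real ((cmod \<eta>)\<^sup>2 / 2) :: complex"
  let ?\<Phi> = "hartogs_affine S \<gamma> (cnj \<eta>) ?q 1 (- \<eta>)"
  have pq: "(cmod (1 * v + (- \<eta>)))\<^sup>2 / 2 + Re (cnj \<eta> * v + ?q) = (cmod v)\<^sup>2 / 2" for v
    by (simp add: cmod_power2) (simp add: power2_eq_square field_simps)
  have \<eta>\<eta>: "cnj \<eta> * \<eta> + ?q = of_real ((cmod \<eta>)\<^sup>2 / 2)"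
    using complex_norm_square[of \<eta>] by (simp add: mult.commute del: of_real_power)
  have \<Phi>_z: "?\<Phi> (z, w) = (X, w - \<eta>)"
    by (simp add: hartogs_affine_def X_def mult.commute)
  have \<Phi>_\<zeta>: "?\<Phi> (\<zeta>, \<eta>) = (\<zeta>', 0)"
    unfolding hartogs_affine_def \<zeta>'_def fst_conv snd_conv \<eta>\<eta> by simp
  have XV: "(X, w - \<eta>) \<in> V" and \<zeta>'V: "(\<zeta>', 0) \<in> V"
    using hartogs_affine_mem_V[OF pq, of "(z, w)"] hartogs_affine_mem_V[OF pq, of "(\<zeta>, \<eta>)"] z \<zeta>
    by (simp_all only: \<Phi>_z \<Phi>_\<zeta>)
  show X: "X \<in> \<Omega>"
    using XV by (rule mem_V_imp_mem_base)
  show \<zeta>': "\<zeta>' \<in> \<Omega>"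
    using \<zeta>'V by (simp add: mem_V_0)
  have "cnj (exp (of_real \<Gamma> * (cnj \<eta> * \<eta> + ?q))) = exp (of_real \<Gamma> * of_real ((cmod \<eta>)\<^sup>2 / 2))"
    unfolding \<eta>\<eta> by (simp only: exp_cnj complex_cnj_mult complex_cnj_complex_of_real)
  then have weights: "exp (of_real \<Gamma> * (cnj \<eta> * w + ?q)) * cnj (exp (of_real \<Gamma> * (cnj \<eta> * \<eta> + ?q)))
      = exp (of_real \<Gamma> * (w * cnj \<eta>))"
    by (simp only: exp_add[symmetric] ring_distribs) (simp add: mult.commute)
  have "K\<^sub>V (z, w) (\<zeta>, \<eta>) = (exp (of_real \<Gamma> * (cnj \<eta> * w + ?q)) * cnj (exp (of_real \<Gamma> * (cnj \<eta> * \<eta> + ?q)))) *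
      K\<^sub>V (X, w - \<eta>) (\<zeta>', 0)"
    using bergman_prod_hartogs_affine[OF norm_one pq, of "(z, w)" "(\<zeta>, \<eta>)"]
    unfolding \<Phi>_z \<Phi>_\<zeta> snd_conv by (simp only: mult_ac)
  also note weights
  also have "K\<^sub>V (X, w - \<eta>) (\<zeta>', 0) = K\<^sub>V (X, 0) (\<zeta>', 0)"
    using XV \<zeta>' by (rule bergman_prod_base_pole)
  finally show "K\<^sub>V (z, w) (\<zeta>, \<eta>) = exp (of_real \<Gamma> * (w * cnj \<eta>)) * K\<^sub>V (X, 0) (\<zeta>', 0)" .
qed

end

section \<open>Integration along orbits\<close>

lemma emeasure_cmod_square_le: "emeasure lborel {w::complex. (cmod w)\<^sup>2 \<le> a} = ennreal (pi * max 0 a)"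
proof -
  have "(cmod w)\<^sup>2 \<le> a \<longleftrightarrow> cmod w \<le> sqrt a" for w
    by (metis abs_norm_cancel real_le_rsqrt sqrt_ge_absD)
  then have "{w. (cmod w)\<^sup>2 \<le> a} = cball 0 (sqrt a)"
    by (simp add: cball_def)
  then show ?thesis
    by (cases "a \<ge> 0") (simp_all add: emeasure_cball unit_ball_vol_2)
qed

lemma distr_cmod_square:
  "distr lborel borel (\<lambda>w::complex. (cmod w)\<^sup>2) = density lborel (\<lambda>s. ennreal (pi * indicator {0..} s))"
proof (rule measure_eqI_generator_eq[where E = "range (\<lambda>a::real. {..a})" and \<Omega> = UNIV
      and A = "\<lambda>i::nat. {..real i}"])
  show "Int_stable (range (\<lambda>a::real. {..a}))"
  proof (rule Int_stableI)
    fix X Y :: "real set" assume "X \<in> range atMost" "Y \<in> range atMost"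
    then obtain a b where "X = {..a}" "Y = {..b}" by blast
    then have "X \<inter> Y = {..min a b}" by auto
    then show "X \<inter> Y \<in> range atMost" by blast
  qed
  have left: "emeasure (distr lborel borel (\<lambda>w::complex. (cmod w)\<^sup>2)) {..a} = ennreal (pi * max 0 a)" for a
    by (simp add: emeasure_distr vimage_def emeasure_cmod_square_le)
  have right: "emeasure (density lborel (\<lambda>s. ennreal (pi * indicator {0..} s))) {..a} = ennreal (pi * max 0 a)"
    for a
  proof -
    have "emeasure (density lborel (\<lambda>s. ennreal (pi * indicator {0..} s))) {..a} =
        (\<integral>\<^sup>+s. ennreal (pi * indicator {0..} s) * indicator {..a} s \<partial>lborel)"
      by (subst emeasure_density) auto
    also have "\<dots> = (\<integral>\<^sup>+s. ennreal pi * indicator {0..a} s \<partial>lborel)"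
      by (intro nn_integral_cong) (auto simp: indicator_def)
    also have "\<dots> = ennreal pi * emeasure lborel {0..a}"
      by (subst nn_integral_cmult) auto
    also have "\<dots> = ennreal (pi * max 0 a)"
      by (cases "a \<ge> 0") (auto simp: ennreal_mult)
    finally show ?thesis .
  qed
  show "emeasure (distr lborel borel (\<lambda>w::complex. (cmod w)\<^sup>2)) X =
      emeasure (density lborel (\<lambda>s. ennreal (pi * indicator {0..} s))) X" if "X \<in> range (\<lambda>a::real. {..a})" for X
    using that left right by auto
  show "emeasure (distr lborel borel (\<lambda>w::complex. (cmod w)\<^sup>2)) {..real i} \<noteq> \<infinity>" for i :: nat
    by (simp add: left)
  show "(\<Union>i::nat. {..real i}) = UNIV"
    using real_arch_simple by auto
qed (auto simp: borel_eq_atMost)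

lemma integral_radial_complex:
  fixes \<phi> :: "real \<Rightarrow> 'a::{banach, second_countable_topology}"
  assumes "continuous_on {0..} \<phi>"
  shows "(LINT w|lborel. \<phi> ((cmod w)\<^sup>2)) = pi *\<^sub>R (LINT s:{0..}|lborel. \<phi> s)"
proof -
  define \<psi> where "\<psi> s = indicator {0..} s *\<^sub>R \<phi> s" for s
  have [measurable]: "\<psi> \<in> borel_measurable borel"
    unfolding \<psi>_def[abs_def] using assms by (intro borel_measurable_continuous_on_indicator) auto
  have "(LINT w|lborel. \<phi> ((cmod w)\<^sup>2)) = (LINT s|distr lborel borel (\<lambda>w::complex. (cmod w)\<^sup>2). \<psi> s)"
    by (subst integral_distr) (auto simp: \<psi>_def)
  also have "\<dots> = (LINT s|lborel. (pi * indicator {0..} s) *\<^sub>R \<psi> s)"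
    unfolding distr_cmod_square by (subst integral_density) auto
  also have "\<dots> = (LINT s|lborel. pi *\<^sub>R \<psi> s)"
    by (intro Bochner_Integration.integral_cong refl) (simp add: \<psi>_def indicator_def)
  also have "\<dots> = pi *\<^sub>R (LINT s|lborel. \<psi> s)"
    by simp
  finally show ?thesis
    by (simp only: \<psi>_def set_lebesgue_integral_def)
qed

lemma nn_integral_gaussian_complex:
  assumes "c > 0"
  shows "(\<integral>\<^sup>+w. ennreal (exp (- (c * (cmod w)\<^sup>2))) \<partial>lborel) = ennreal (pi / c)"
proof -
  have "(\<integral>\<^sup>+w. ennreal (exp (- (c * (cmod w)\<^sup>2))) \<partial>lborel)
      = (\<integral>\<^sup>+s. ennreal (exp (- (c * s))) \<partial>distr lborel borel (\<lambda>w::complex. (cmod w)\<^sup>2))"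
    by (simp add: nn_integral_distr)
  also have "\<dots> = (\<integral>\<^sup>+s. ennreal (pi * indicator {0..} s) * ennreal (exp (- (c * s))) \<partial>lborel)"
    unfolding distr_cmod_square by (simp add: nn_integral_density)
  also have "\<dots> = (\<integral>\<^sup>+s. ennreal pi * (ennreal (exp (- c * s)) * indicator {0..} s) \<partial>lborel)"
    by (intro nn_integral_cong) (auto simp: indicator_def)
  also have "\<dots> = ennreal pi * ennreal (exp (- c * 0) / c)"
    using has_integral_exp_minus_to_infinity[OF assms, of 0]
    by (simp add: nn_integral_cmult nn_integral_has_integral_lebesgue')
  finally show ?thesis
    using assms by (simp flip: ennreal_mult)
qed

lemma set_integral_shift_atLeast:
  fixes \<phi> :: "real \<Rightarrow> 'a::{banach, second_countable_topology}"
  shows "(LINT s:{0..}|lborel. \<phi> (a + s)) = (LINT s:{a..}|lborel. \<phi> s)"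
  unfolding set_lebesgue_integral_def
  by (subst (2) lborel_integral_real_affine[of 1 _ a])
    (auto intro!: Bochner_Integration.integral_cong simp: indicator_def)

lemma has_vector_derivative_integral_atLeast:
  fixes \<phi> :: "real \<Rightarrow> 'a::euclidean_space"
  assumes cont: "continuous_on {a..} \<phi>" and int: "set_integrable lborel {a..} \<phi>" and "a \<le> b"
  shows "((\<lambda>t. LINT s:{t..}|lborel. \<phi> s) has_vector_derivative - \<phi> a) (at a within {a..b})"
proof -
  have split: "(LINT s:{a..}|lborel. \<phi> s) - integral {a..t} \<phi> = (LINT s:{t..}|lborel. \<phi> s)" if "t \<in> {a..b}" for t
  proof -
    have tail: "set_integrable lborel {t..} \<phi>"
      using that by (intro set_integrable_subset[OF int]) auto
    have "(\<phi> has_integral integral {a..t} \<phi>) {a..t}"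
      using cont by (intro integrable_integral integrable_continuous_interval) (auto intro: continuous_on_subset)
    moreover have "(\<phi> has_integral (LINT s:{t..}|lborel. \<phi> s)) {t..}"
      using set_borel_integral_eq_integral[OF tail] by (simp add: integrable_integral)
    moreover have "{a..t} \<inter> {t..} = {t}" "{a..t} \<union> {t..} = {a..}"
      using that by auto
    ultimately have "(\<phi> has_integral (integral {a..t} \<phi> + (LINT s:{t..}|lborel. \<phi> s))) {a..}"
      using has_integral_Un[of \<phi> _ "{a..t}" _ "{t..}"] by simp
    then show ?thesis
      using set_borel_integral_eq_integral(2)[OF int] by (simp add: integral_unique)
  qed
  have "((\<lambda>t. integral {a..t} \<phi>) has_vector_derivative \<phi> a) (at a within {a..b})"
    using cont \<open>a \<le> b\<close> by (intro integral_has_vector_derivative) (auto intro: continuous_on_subset)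
  then have "((\<lambda>t. (LINT s:{a..}|lborel. \<phi> s) - integral {a..t} \<phi>) has_vector_derivative - \<phi> a)
      (at a within {a..b})"
    by (auto intro!: derivative_eq_intros)
  then show ?thesis
    by (rule has_vector_derivative_transform[rotated 2]) (use split \<open>a \<le> b\<close> in auto)
qed

definition weighted_euler :: "'N set \<Rightarrow> ('N \<Rightarrow> real) \<Rightarrow> (complex^'N \<Rightarrow> complex) \<Rightarrow> complex^'N \<Rightarrow> complex" where
  "weighted_euler S \<gamma> f x = (\<Sum>j\<in>S. of_real (\<gamma> j) * (f x + frechet_derivative f (at x) (axis j (x $ j))))"

definition damp :: "'N set \<Rightarrow> ('N \<Rightarrow> real) \<Rightarrow> real \<Rightarrow> (complex^'N::finite \<Rightarrow> complex) \<Rightarrow> complex^'N \<Rightarrow> complex" where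
  "damp S \<gamma> s f x = of_real (exp (- (sum \<gamma> S * s))) * f (expscale S \<gamma> (- of_real s) x)"

lemma damp_0 [simp]: "damp S \<gamma> 0 f = f"
  by (simp add: damp_def fun_eq_iff)

lemma damp_damp: "damp S \<gamma> a (damp S \<gamma> s f) = damp S \<gamma> (a + s) f"
  by (simp add: damp_def fun_eq_iff expscale_add ring_distribs exp_diff exp_minus field_simps exp_add)

lemma has_vector_derivative_damp:
  assumes f: "f differentiable at x"
  shows "((\<lambda>s. damp S \<gamma> s f x) has_vector_derivative - weighted_euler S \<gamma> f x) (at 0 within T)"
proof -
  define L where "L = frechet_derivative f (at x)"
  have L: "(f has_derivative L) (at x)"
    using f by (simp add: L_def frechet_derivative_works)
  interpret linear L
    using L by (rule has_derivative_linear)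
  define v where "v = (\<Sum>j\<in>S. \<gamma> j *\<^sub>R axis j (x $ j))"
  have v_nth: "v $ j = (if j \<in> S then of_real (\<gamma> j) * x $ j else 0)" for j
    by (simp add: v_def axis_def scaleR_conv_of_real[where 'a = complex] if_distrib[of "\<lambda>t. _ * t"] cong: if_cong)
  have "((\<lambda>s. expscale S \<gamma> (- of_real s) x) has_derivative (\<lambda>h. h *\<^sub>R (- v))) (at 0 within T)"
  proof (rule has_derivative_vecI)
    fix j
    have "((\<lambda>t. exp (of_real (\<gamma> j) * - t) * x $ j) has_field_derivative - (of_real (\<gamma> j) * x $ j))
        (at (of_real 0))"
      by (auto intro!: derivative_eq_intros)
    from has_vector_derivative_real_field[OF this, of T]
    show "((\<lambda>s. expscale S \<gamma> (- of_real s) x $ j) has_derivative (\<lambda>h. (h *\<^sub>R (- v)) $ j))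
        (at 0 within T)"
      by (cases "j \<in> S") (simp_all add: expscale_nth v_nth has_vector_derivative_def)
  qed
  then have "((\<lambda>s. f (expscale S \<gamma> (- of_real s) x)) has_derivative (\<lambda>h. L (h *\<^sub>R (- v)))) (at 0 within T)"
    using has_derivative_compose[of _ _ 0 T f L] L by simp
  then have "((\<lambda>s. f (expscale S \<gamma> (- of_real s) x)) has_vector_derivative - L v) (at 0 within T)"
    by (simp add: has_vector_derivative_def scale neg)
  moreover have "((\<lambda>s. complex_of_real (exp (- (sum \<gamma> S * s)))) has_vector_derivative of_real (- sum \<gamma> S))
      (at 0 within T)"
    by (intro has_vector_derivative_of_real)
      (auto intro!: derivative_eq_intros simp flip: has_real_derivative_iff_has_vector_derivative)
  ultimately have "((\<lambda>s. damp S \<gamma> s f x) has_vector_derivative - L v + of_real (- sum \<gamma> S) * f x)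
      (at 0 within T)"
    unfolding damp_def using has_vector_derivative_mult by fastforce
  also have "- L v + of_real (- sum \<gamma> S) * f x = - weighted_euler S \<gamma> f x"
    by (simp add: v_def weighted_euler_def L_def[symmetric] sum scale scaleR_conv_of_real[where 'a = complex]
        ring_distribs sum.distrib sum_distrib_right)
  finally show ?thesis .
qed

section \<open>The kernel formula\<close>

context hartogs
begin

lemma \<Gamma>_pos: "\<Gamma> > 0"
  using S_nonempty \<gamma>_pos by (intro sum_pos) auto

lemma bounded_damp:
  assumes "continuous_on \<Omega> f" "x \<in> \<Omega>"
  obtains B where "B \<ge> 0" "\<And>s. s \<ge> 0 \<Longrightarrow> cmod (damp S \<gamma> s f x) \<le> B * exp (- (\<Gamma> * s))"
proof -
  obtain B where B: "\<And>a. Re a \<le> 0 \<Longrightarrow> cmod (f (expscale S \<gamma> a x)) \<le> B"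
    using bounded_on_expscale_orbit[OF assms] by blast
  have "B \<ge> 0"
    using order_trans[OF norm_ge_zero B[of 0]] by simp
  moreover have "cmod (damp S \<gamma> s f x) \<le> B * exp (- (\<Gamma> * s))" if "s \<ge> 0" for s
    using B[of "- of_real s"] that by (simp add: damp_def norm_mult mult.commute)
  ultimately show thesis ..
qed

lemma continuous_on_damp:
  assumes f: "continuous_on \<Omega> f" and x: "x \<in> \<Omega>"
  shows "continuous_on {0..} (\<lambda>s. damp S \<gamma> s f x)"
  unfolding damp_def
  by (intro continuous_intros continuous_on_compose2[OF f]) (auto intro: expscale_mem[OF x])

lemma set_integrable_damp:
  assumes f: "continuous_on \<Omega> f" and x: "x \<in> \<Omega>"
  shows "set_integrable lborel {0..} (\<lambda>s. damp S \<gamma> s f x)"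
proof -
  obtain B where B: "\<And>s. s \<ge> 0 \<Longrightarrow> cmod (damp S \<gamma> s f x) \<le> B * exp (- (\<Gamma> * s))"
    using bounded_damp[OF assms] by blast
  have "(\<lambda>s. exp (- \<Gamma> * s)) absolutely_integrable_on {0..}"
    using integrable_on_exp_minus_to_infinity[OF \<Gamma>_pos] by (rule nonnegative_absolutely_integrable_1) simp
  then have "set_integrable lborel {0..} (\<lambda>s. exp (- \<Gamma> * s))"
    unfolding set_integrable_def by (subst (asm) integrable_completion) simp_all
  then have "set_integrable lborel {0..} (\<lambda>s. B * exp (- \<Gamma> * s))"
    by (rule set_integrable_mult_right)
  then show ?thesis
  proof (rule set_integrable_bound)
    show "set_borel_measurable lborel {0..} (\<lambda>s. damp S \<gamma> s f x)"
      using borel_measurable_continuous_on_indicator[OF _ continuous_on_damp[OF assms]]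
      by (simp add: set_borel_measurable_def)
    show "AE s in lborel. s \<in> {0..} \<longrightarrow> cmod (damp S \<gamma> s f x) \<le> norm (B * exp (- \<Gamma> * s))"
      using B by (intro AE_I2) (auto intro: order_trans[OF _ abs_ge_self])
  qed
qed

lemma V_slice_eq: "V_slice S \<gamma> \<Omega> w = expscale S \<gamma> (of_real ((cmod w)\<^sup>2 / 2)) -` \<Omega>"
  by (auto simp: V_slice_def mem_V)

lemma open_V_slice: "open (V_slice S \<gamma> \<Omega> w)"
  unfolding V_slice_def using open_V by (rule open_slice)

lemma V_slice_subset: "V_slice S \<gamma> \<Omega> w \<subseteq> \<Omega>"
  by (auto simp: V_slice_def dest: mem_V_imp_mem_base)

lemma bergman_vec_V_slice:
  "bergman_vec (V_slice S \<gamma> \<Omega> w) x y = of_real (exp (\<Gamma> * (cmod w)\<^sup>2)) *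
    K\<^sub>\<Omega> (expscale S \<gamma> (of_real ((cmod w)\<^sup>2 / 2)) x) (expscale S \<gamma> (of_real ((cmod w)\<^sup>2 / 2)) y)"
  unfolding V_slice_eq bergman_vec_expscale[OF open_\<Omega>] by simp

text \<open>A half step along the orbit moves from one argument of \<open>K\<^sub>\<Omega>\<close> to the other, so that on the slice over \<open>w\<close>
  the kernel of \<open>\<Omega>\<close> is, up to a factor, the kernel of the slice with its pole moved a full step.\<close>
lemma bergman_vec_restrict_V_slice:
  assumes x: "x \<in> \<Omega>" and y: "y \<in> V_slice S \<gamma> \<Omega> w"
  shows "K\<^sub>\<Omega> y x = of_real (exp (- (\<Gamma> * (cmod w)\<^sup>2))) *
    bergman_vec (V_slice S \<gamma> \<Omega> w) y (expscale S \<gamma> (- of_real ((cmod w)\<^sup>2)) x)"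
proof -
  let ?h = "of_real ((cmod w)\<^sup>2 / 2) :: complex"
  have y': "expscale S \<gamma> ?h y \<in> \<Omega>" and "y \<in> \<Omega>"
    using y V_slice_subset by (auto simp: V_slice_eq)
  have "expscale S \<gamma> (- ?h) x \<in> \<Omega>"
    using x by (intro expscale_mem) auto
  then have "K\<^sub>\<Omega> (expscale S \<gamma> (- ?h) (expscale S \<gamma> ?h y)) x
      = K\<^sub>\<Omega> (expscale S \<gamma> ?h y) (expscale S \<gamma> (cnj (- ?h)) x)"
    using x y' \<open>y \<in> \<Omega>\<close> by (intro bergman_vec_expscale_adjoint) (simp_all add: expscale_add)
  moreover have "?h + - of_real ((cmod w)\<^sup>2) = cnj (- ?h)"
    by simp
  ultimately show ?thesis
    by (simp add: bergman_vec_V_slice expscale_add exp_minus)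
qed

lemma expscale_mem_V_slice:
  assumes "x \<in> \<Omega>"
  shows "expscale S \<gamma> (- of_real ((cmod w)\<^sup>2)) x \<in> V_slice S \<gamma> \<Omega> w"
proof -
  have "expscale S \<gamma> (of_real ((cmod w)\<^sup>2 / 2) + - of_real ((cmod w)\<^sup>2)) x \<in> \<Omega>"
    using assms by (intro expscale_mem) auto
  then show ?thesis
    by (simp add: V_slice_eq expscale_add)
qed

lemma L2_inner_V_slice_bergman_vec:
  assumes x: "x \<in> \<Omega>" and f: "f \<in> A2 J_vec (V_slice S \<gamma> \<Omega> w)"
  shows "L2_inner (V_slice S \<gamma> \<Omega> w) f (\<lambda>y. K\<^sub>\<Omega> y x) = damp S \<gamma> ((cmod w)\<^sup>2) f x"
proof -
  let ?x = "expscale S \<gamma> (- of_real ((cmod w)\<^sup>2)) x"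
  let ?K = "\<lambda>y. bergman_vec (V_slice S \<gamma> \<Omega> w) y ?x"
  have "f ?x = L2_inner (V_slice S \<gamma> \<Omega> w) f ?K"
    using expscale_mem_V_slice[OF x] f unfolding bergman_vec_def
    by (intro bergman_gen_reproducing open_V_slice complex_structure_vec)
  moreover have "L2_inner (V_slice S \<gamma> \<Omega> w) f (\<lambda>y. K\<^sub>\<Omega> y x)
      = L2_inner (V_slice S \<gamma> \<Omega> w) f (\<lambda>y. of_real (exp (- (\<Gamma> * (cmod w)\<^sup>2))) * ?K y)"
    using bergman_vec_restrict_V_slice[OF x] by (intro L2_inner_cong) simp_all
  ultimately show ?thesis
    by (simp add: L2_inner_cmult_right damp_def)
qed

lemma bergman_vec_A2_V_slice:
  assumes "x \<in> \<Omega>"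
  shows "(\<lambda>y. K\<^sub>\<Omega> y x) \<in> A2 J_vec (V_slice S \<gamma> \<Omega> w)"
  using bergman_vec_A2[OF assms] V_slice_subset[of w] open_V_slice[of w]
  by (auto simp: A2_iff_set_integrable open_\<Omega> intro: cholo_on_subset set_integrable_subset)

lemma L2_norm2_V_slice_bergman_vec:
  assumes x: "x \<in> \<Omega>"
  shows "L2_norm2 (V_slice S \<gamma> \<Omega> w) (\<lambda>y. K\<^sub>\<Omega> y x) = cmod (damp S \<gamma> ((cmod w)\<^sup>2) (\<lambda>y. K\<^sub>\<Omega> y x) x)"
proof -
  have "of_real (L2_norm2 (V_slice S \<gamma> \<Omega> w) (\<lambda>y. K\<^sub>\<Omega> y x)) = damp S \<gamma> ((cmod w)\<^sup>2) (\<lambda>y. K\<^sub>\<Omega> y x) x"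
    using L2_inner_V_slice_bergman_vec[OF x bergman_vec_A2_V_slice[OF x]] by (simp add: L2_inner_self)
  from this[symmetric] show ?thesis
    by (simp add: L2_norm2_nonneg)
qed

lemma bergman_vec_lift_A2:
  assumes x: "x \<in> \<Omega>"
  shows "(\<lambda>z. K\<^sub>\<Omega> (fst z) x) \<in> A2 J_prod V"
proof -
  let ?q = "\<lambda>y. K\<^sub>\<Omega> y x" and ?F = "\<lambda>z. ennreal ((cmod (K\<^sub>\<Omega> (fst z) x))\<^sup>2) * indicator V z"
  have "cholo_map J_prod J_vec fst V"
    by (intro cholo_map_linear linear_fst) auto
  then have lift_cholo: "cholo_on J_prod (\<lambda>z. ?q (fst z)) V"
    using bergman_vec_cholo_on[OF x] by (rule cholo_on_compose) (auto dest: mem_V_imp_mem_base)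
  obtain B where "B \<ge> 0" and B: "\<And>s. s \<ge> 0 \<Longrightarrow> cmod (damp S \<gamma> s ?q x) \<le> B * exp (- (\<Gamma> * s))"
    using bounded_damp[OF cholo_on_imp_continuous_on[OF bergman_vec_cholo_on[OF x]] x] by blast
  have "?F \<in> borel_measurable borel"
    using open_V cholo_on_imp_continuous_on[OF lift_cholo] by (rule borel_measurable_cmod_square_on_open)
  then have "(\<integral>\<^sup>+z\<in>V. ennreal ((cmod (?q (fst z)))\<^sup>2) \<partial>lborel) = (\<integral>\<^sup>+w. \<integral>\<^sup>+y. ?F (y, w) \<partial>lborel \<partial>lborel)"
    by (rule nn_integral_lborel_slices[symmetric])
  also have "\<dots> = (\<integral>\<^sup>+w. (\<integral>\<^sup>+y\<in>V_slice S \<gamma> \<Omega> w. ennreal ((cmod (?q y))\<^sup>2) \<partial>lborel) \<partial>lborel)"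
    by (simp add: V_slice_def indicator_def)
  also have "\<dots> = (\<integral>\<^sup>+w. ennreal (cmod (damp S \<gamma> ((cmod w)\<^sup>2) ?q x)) \<partial>lborel)"
    by (simp only: nn_integral_A2[OF open_V_slice bergman_vec_A2_V_slice[OF x]]
        L2_norm2_V_slice_bergman_vec[OF x])
  also have "\<dots> \<le> (\<integral>\<^sup>+w. ennreal B * ennreal (exp (- (\<Gamma> * (cmod w)\<^sup>2))) \<partial>(lborel :: complex measure))"
    using B \<open>B \<ge> 0\<close> by (intro nn_integral_mono) (simp add: ennreal_leI flip: ennreal_mult)
  also have "\<dots> = ennreal B * ennreal (pi / \<Gamma>)"
    by (simp add: nn_integral_cmult nn_integral_gaussian_complex[OF \<Gamma>_pos])
  also have "\<dots> < \<infinity>"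
    by (simp add: ennreal_mult_less_top)
  finally show ?thesis
    using lift_cholo by (simp add: A2_iff_nn_integral[OF open_V])
qed

lemma cholo_on_bergman_prod_base:
  assumes "\<zeta> \<in> \<Omega>"
  shows "cholo_on J_vec (\<lambda>y. K\<^sub>V (y, 0) (\<zeta>, 0)) \<Omega>"
proof -
  have "cholo_map J_vec J_prod (\<lambda>y. (y, 0)) \<Omega>"
    by (intro cholo_map_linear linearI) auto
  moreover have "cholo_on J_prod (\<lambda>z. K\<^sub>V z (\<zeta>, 0)) V"
    using assms by (intro A2_cholo_on open_V bergman_prod_A2) (simp add: mem_V_0)
  ultimately show ?thesis
    by (rule cholo_on_compose) (simp add: mem_V_0)
qed

lemma AE_L2_inner_V_slice_bergman_prod:
  assumes x: "x \<in> \<Omega>" and \<zeta>: "\<zeta> \<in> \<Omega>"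
  shows "AE w in lborel. L2_inner (V_slice S \<gamma> \<Omega> w) (\<lambda>y. K\<^sub>V (y, w) (\<zeta>, 0)) (\<lambda>y. K\<^sub>\<Omega> y x) =
    damp S \<gamma> ((cmod w)\<^sup>2) (\<lambda>y. K\<^sub>V (y, 0) (\<zeta>, 0)) x"
proof -
  have "(\<lambda>z. K\<^sub>V z (\<zeta>, 0)) \<in> A2 J_prod V"
    using \<zeta> by (intro bergman_prod_A2) (simp add: mem_V_0)
  then have "AE w in lborel. (\<lambda>y. K\<^sub>V (y, w) (\<zeta>, 0)) \<in> A2 J_vec (V_slice S \<gamma> \<Omega> w)"
    unfolding V_slice_def by (rule A2_slice_AE[OF open_V, rotated]) simp
  then show ?thesis
  proof (rule AE_mp, intro AE_I2 impI)
    fix w assume "(\<lambda>y. K\<^sub>V (y, w) (\<zeta>, 0)) \<in> A2 J_vec (V_slice S \<gamma> \<Omega> w)"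
    then have "L2_inner (V_slice S \<gamma> \<Omega> w) (\<lambda>y. K\<^sub>V (y, w) (\<zeta>, 0)) (\<lambda>y. K\<^sub>\<Omega> y x) =
        damp S \<gamma> ((cmod w)\<^sup>2) (\<lambda>y. K\<^sub>V (y, w) (\<zeta>, 0)) x"
      by (rule L2_inner_V_slice_bergman_vec[OF x])
    also have "\<dots> = damp S \<gamma> ((cmod w)\<^sup>2) (\<lambda>y. K\<^sub>V (y, 0) (\<zeta>, 0)) x"
      using bergman_prod_base_pole[OF _ \<zeta>] expscale_mem_V_slice[OF x, of w] by (simp add: damp_def V_slice_def)
    finally show "L2_inner (V_slice S \<gamma> \<Omega> w) (\<lambda>y. K\<^sub>V (y, w) (\<zeta>, 0)) (\<lambda>y. K\<^sub>\<Omega> y x) =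
        damp S \<gamma> ((cmod w)\<^sup>2) (\<lambda>y. K\<^sub>V (y, 0) (\<zeta>, 0)) x" .
  qed
qed

lemma bergman_vec_eq_integral_bergman_prod:
  assumes x: "x \<in> \<Omega>" and \<zeta>: "\<zeta> \<in> \<Omega>"
  shows "K\<^sub>\<Omega> x \<zeta> = (LINT w|lborel. damp S \<gamma> ((cmod w)\<^sup>2) (\<lambda>y. K\<^sub>V (y, 0) (\<zeta>, 0)) x)"
proof -
  let ?q = "\<lambda>z :: (complex^'N) \<times> complex. K\<^sub>\<Omega> (fst z) x" and ?k = "\<lambda>z. K\<^sub>V z (\<zeta>, 0)"
  let ?I = "\<lambda>w. L2_inner (V_slice S \<gamma> \<Omega> w) (\<lambda>y. ?k (y, w)) (\<lambda>y. K\<^sub>\<Omega> y x)"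
  let ?d = "\<lambda>w. damp S \<gamma> ((cmod w)\<^sup>2) (\<lambda>y. ?k (y, 0)) x"
  have \<zeta>V: "(\<zeta>, 0) \<in> V"
    using \<zeta> by (simp add: mem_V_0)
  have integrable: "set_integrable lborel V (\<lambda>z. ?k z * cnj (?q z))"
    by (rule A2_mult_integrable[OF open_V bergman_prod_A2[OF \<zeta>V] bergman_vec_lift_A2[OF x]])
  have I_eq: "?I w = (LINT y:{y. (y, w) \<in> V}|lborel. ?k (y, w) * cnj (?q (y, w)))" for w
    by (simp add: L2_inner_def V_slice_def)
  have "continuous_on {0..} (\<lambda>s. damp S \<gamma> s (\<lambda>y. ?k (y, 0)) x)"
    using cholo_on_imp_continuous_on[OF cholo_on_bergman_prod_base[OF \<zeta>]] x by (rule continuous_on_damp)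
  then have "continuous_on UNIV ?d"
    by (rule continuous_on_compose2) (auto intro!: continuous_intros)
  then have "?d \<in> borel_measurable lborel"
    by (simp add: borel_measurable_continuous_onI)
  moreover have "?I \<in> borel_measurable lborel"
    using borel_measurable_integrable[OF integrable_set_integral_slice[OF integrable]] by (simp only: I_eq)
  ultimately have "(LINT w|lborel. ?d w) = (LINT w|lborel. ?I w)"
    using AE_L2_inner_V_slice_bergman_prod[OF x \<zeta>] by (intro integral_cong_AE[symmetric])
  also have "\<dots> = L2_inner V ?k ?q"
    using set_integral_lborel_slices[OF integrable] by (simp add: L2_inner_def V_slice_def)
  also have "\<dots> = cnj (L2_inner V ?q ?k)"
    by (rule cnj_L2_inner[symmetric])
  also have "\<dots> = cnj (?q (\<zeta>, 0))"
    using bergman_gen_reproducing[OF open_V complex_structure_prod \<zeta>V bergman_vec_lift_A2[OF x]]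
    by (simp add: bergman_prod_def)
  also have "\<dots> = K\<^sub>\<Omega> x \<zeta>"
    using bergman_vec_hermitian[OF x \<zeta>] by simp
  finally show ?thesis ..
qed

lemma damp_bergman_vec:
  assumes x: "x \<in> \<Omega>" and \<zeta>: "\<zeta> \<in> \<Omega>" and "a \<ge> 0"
  shows "damp S \<gamma> a (\<lambda>y. K\<^sub>\<Omega> y \<zeta>) x = of_real pi * (LINT s:{a..}|lborel. damp S \<gamma> s (\<lambda>y. K\<^sub>V (y, 0) (\<zeta>, 0)) x)"
proof -
  let ?k = "\<lambda>y. K\<^sub>V (y, 0) (\<zeta>, 0)" and ?x = "expscale S \<gamma> (- of_real a) x"
  have k: "continuous_on \<Omega> ?k"
    using cholo_on_bergman_prod_base[OF \<zeta>] by (rule cholo_on_imp_continuous_on)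
  have x': "?x \<in> \<Omega>"
    using x \<open>a \<ge> 0\<close> by (intro expscale_mem) auto
  have "K\<^sub>\<Omega> ?x \<zeta> = of_real pi * (LINT s:{0..}|lborel. damp S \<gamma> s ?k ?x)"
    unfolding bergman_vec_eq_integral_bergman_prod[OF x' \<zeta>] scaleR_conv_of_real[symmetric]
    by (rule integral_radial_complex[OF continuous_on_damp[OF k x']])
  then have "damp S \<gamma> a (\<lambda>y. K\<^sub>\<Omega> y \<zeta>) x = of_real pi * (LINT s:{0..}|lborel. damp S \<gamma> a (damp S \<gamma> s ?k) x)"
    by (simp add: damp_def[of S \<gamma> a])
  also have "(LINT s:{0..}|lborel. damp S \<gamma> a (damp S \<gamma> s ?k) x) = (LINT s:{a..}|lborel. damp S \<gamma> s ?k x)"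
    unfolding damp_damp by (rule set_integral_shift_atLeast)
  finally show ?thesis .
qed

lemma bergman_prod_base:
  assumes x: "x \<in> \<Omega>" and \<zeta>: "\<zeta> \<in> \<Omega>"
  shows "K\<^sub>V (x, 0) (\<zeta>, 0) = weighted_euler S \<gamma> (\<lambda>y. K\<^sub>\<Omega> y \<zeta>) x / of_real pi"
proof -
  let ?k = "\<lambda>y. K\<^sub>V (y, 0) (\<zeta>, 0)" and ?q = "\<lambda>y. K\<^sub>\<Omega> y \<zeta>"
  have k: "continuous_on \<Omega> ?k"
    using cholo_on_bergman_prod_base[OF \<zeta>] by (rule cholo_on_imp_continuous_on)
  have "((\<lambda>a. LINT s:{a..}|lborel. damp S \<gamma> s ?k x) has_vector_derivative - ?k x) (at 0 within {0..1})"
    using has_vector_derivative_integral_atLeast[OF continuous_on_damp[OF k x] set_integrable_damp[OF k x], of 1]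
    by simp
  then have "((\<lambda>a. of_real pi * (LINT s:{a..}|lborel. damp S \<gamma> s ?k x)) has_vector_derivative
      of_real pi * - ?k x) (at 0 within {0..1})"
    by (rule has_vector_derivative_mult_right)
  then have tail: "((\<lambda>a. damp S \<gamma> a ?q x) has_vector_derivative of_real pi * - ?k x) (at 0 within {0..1})"
    by (rule has_vector_derivative_transform[rotated 2]) (simp_all add: damp_bergman_vec[OF x \<zeta>] del: damp_0)
  have "?q differentiable at x"
    using bergman_vec_cholo_on[OF \<zeta>] x unfolding cholo_on_def differentiable_def by blast
  then have "((\<lambda>a. damp S \<gamma> a ?q x) has_vector_derivative - weighted_euler S \<gamma> ?q x) (at 0 within {0..1})"
    by (rule has_vector_derivative_damp)
  with tail have "of_real pi * - ?k x = - weighted_euler S \<gamma> ?q x"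
    by (intro vector_derivative_unique_within_closed_interval[of 0 1 0, unfolded box_real]) auto
  then show ?thesis
    by (simp add: field_simps)
qed

end

lemma pderiv_z_expscale:
  assumes L: "(q has_derivative L) (at (expscale S \<gamma> a z))" "\<And>v. L (\<i> *s v) = \<i> * L v"
    and F: "\<And>x. F (x, w) = C * q (expscale S \<gamma> a x)" and "j \<in> S"
  shows "z $ j * pderiv_z F j (z, w) = C * L (axis j (expscale S \<gamma> a z $ j))"
proof -
  let ?X = "expscale S \<gamma> a z" and ?e = "exp (of_real (\<gamma> j) * a)"
  let ?v = "axis j ?e :: complex^'a"
  have line: "expscale S \<gamma> a (\<chi> k. if k = j then t else z $ k) = (?X - z $ j *s ?v) + cscale J_vec t ?v" for t
    using \<open>j \<in> S\<close> by (auto simp: cscale_vec vec_eq_iff expscale_nth axis_def)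
  have "((\<lambda>t. q ((?X - z $ j *s ?v) + cscale J_vec t ?v)) has_field_derivative L ?v) (at (z $ j))"
    by (rule has_field_derivative_cscale_line) (simp_all add: cscale_vec L)
  then have "pderiv_z F j (z, w) = C * L ?v"
    unfolding pderiv_z_def fst_conv snd_conv F line by (intro DERIV_imp_deriv DERIV_cmult)
  moreover have "z $ j * L ?v = L (z $ j *s ?v)"
    using linear_cscale_complex_linear[of L J_vec, OF has_derivative_linear[OF L(1)] L(2)]
    by (simp add: cscale_vec)
  moreover have "z $ j *s ?v = axis j (?X $ j)"
    using \<open>j \<in> S\<close> by (auto simp: vec_eq_iff axis_def expscale_nth)
  ultimately show ?thesis
    by (simp add: mult.left_commute)
qed

lemma D_op_expscale:
  assumes q: "cholo_on J_vec q D" "expscale S \<gamma> a z \<in> D" and F: "\<And>x. F (x, w) = C * q (expscale S \<gamma> a x)"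
  shows "D_op S \<gamma> \<eta> F (z, w) = exp (of_real (sum \<gamma> S) * (w * cnj \<eta> - of_real ((cmod \<eta>)\<^sup>2))) / of_real pi *
    (C * weighted_euler S \<gamma> q (expscale S \<gamma> a z))"
proof -
  let ?X = "expscale S \<gamma> a z"
  obtain L where L: "(q has_derivative L) (at ?X)" "\<And>v. L (\<i> *s v) = \<i> * L v"
    using q unfolding cholo_on_def by blast
  have "(\<Sum>j\<in>S. of_real (\<gamma> j) * (F (z, w) + z $ j * pderiv_z F j (z, w)))
      = (\<Sum>j\<in>S. of_real (\<gamma> j) * (C * q ?X + C * L (axis j (?X $ j))))"
    by (intro sum.cong refl) (simp add: F pderiv_z_expscale[OF L F])
  also have "\<dots> = C * weighted_euler S \<gamma> q ?X"
    by (simp add: weighted_euler_def frechet_derivative_at[OF L(1), symmetric] sum_distrib_left algebra_simps)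
  finally show ?thesis
    by (simp add: D_op_def)
qed

lemma expscale_l_map:
  "expscale S \<gamma> (of_real ((cmod \<eta>)\<^sup>2 / 2)) (l_map S \<gamma> x w \<eta>) =
    expscale S \<gamma> (w * cnj \<eta> - of_real ((cmod \<eta>)\<^sup>2 / 2)) x"
proof -
  have "l_map S \<gamma> x w \<eta> = expscale S \<gamma> (w * cnj \<eta> - of_real ((cmod \<eta>)\<^sup>2)) x"
    by (simp add: l_map_def vec_eq_iff expscale_nth mult.commute)
  then show ?thesis
    by (simp add: expscale_add field_simps)
qed

theorem theorem2:
  fixes S :: "'N::finite set" and \<Omega> :: "(complex^'N) set" and \<gamma> :: "'N \<Rightarrow> real"
  assumes "S \<noteq> {}"
    and "open \<Omega>" and "connected \<Omega>" and "\<Omega> \<noteq> {}"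
    and "star_hartogs S \<Omega>"
    and "\<forall>j\<in>S. \<gamma> j > 0"
    and "(z, w) \<in> V_gamma S \<gamma> \<Omega>" and "(\<zeta>, \<eta>) \<in> V_gamma S \<gamma> \<Omega>"
  shows "bergman_prod (V_gamma S \<gamma> \<Omega>) (z, w) (\<zeta>, \<eta>) =
    D_op S \<gamma> \<eta> (\<lambda>(x, v). bergman_vec (V_slice S \<gamma> \<Omega> \<eta>) (l_map S \<gamma> x v \<eta>) \<zeta>) (z, w)"
proof -
  interpret hartogs S \<gamma> \<Omega>
    by unfold_locales (use assms in auto)
  let ?X = "expscale S \<gamma> (w * cnj \<eta> - of_real ((cmod \<eta>)\<^sup>2 / 2)) z"
    and ?\<zeta> = "expscale S \<gamma> (of_real ((cmod \<eta>)\<^sup>2 / 2)) \<zeta>"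
  let ?C = "of_real (exp (\<Gamma> * (cmod \<eta>)\<^sup>2)) :: complex" and ?c = "of_real ((cmod \<eta>)\<^sup>2) :: complex"
  note base = bergman_prod_shift_to_base[OF assms(7,8)]
  have "K\<^sub>V (z, w) (\<zeta>, \<eta>) =
      exp (of_real \<Gamma> * (w * cnj \<eta>)) * (weighted_euler S \<gamma> (\<lambda>y. K\<^sub>\<Omega> y ?\<zeta>) ?X / of_real pi)"
    by (simp only: base(3) bergman_prod_base[OF base(1,2)])
  also have "exp (of_real \<Gamma> * (w * cnj \<eta>)) = exp (of_real \<Gamma> * (w * cnj \<eta> - ?c)) * ?C"
    by (simp add: exp_of_real[symmetric] ring_distribs flip: exp_add)
  also have "\<dots> * (weighted_euler S \<gamma> (\<lambda>y. K\<^sub>\<Omega> y ?\<zeta>) ?X / of_real pi) =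
      D_op S \<gamma> \<eta> (\<lambda>(x, v). bergman_vec (V_slice S \<gamma> \<Omega> \<eta>) (l_map S \<gamma> x v \<eta>) \<zeta>) (z, w)"
    by (subst D_op_expscale[OF bergman_vec_cholo_on[OF base(2)] base(1), where C = ?C])
      (simp_all only: prod.case bergman_vec_V_slice expscale_l_map mult.assoc times_divide_eq_right
        times_divide_eq_left)
  finally show ?thesis .
qed

end
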